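(* Suppose that $m,n\to\infty$ with $0<n\le m$ and $n/m\to\alpha\in[0,1]$. Then, for every $k=0,1,\dots$, with convergence in probability, (i) $\mathbb P\bigl(d^{\mathsf U}(\mathcal T_{m,n})=k\bigm|\mathcal T_{m,n}\bigr)=m^{-1}n_k^{\mathsf U}(\mathcal T_{m,n})\overset{\mathrm p}{\longrightarrow}p^{\mathsf U}_\alpha(k)$, (ii) $\mathbb P\bigl(d^{\mathsf L}(\mathcal T_{m,n})=k\bigm|\mathcal T_{m,n}\bigr)=n^{-1}n_k^{\mathsf L}(\mathcal T_{m,n})\overset{\mathrm p}{\longrightarrow}p^{\mathsf L}_\alpha(k)$, (iii) $\mathbb P\bigl(d^{\mathsf E}(\mathcal T_{m,n})=k\bigm|\mathcal T_{m,n}\bigr)=n^{-1}n_k^{\mathsf E}(\mathcal T_{m,n})\overset{\mathrm p}{\longrightarrow}p^{\mathsf E}_\alpha(k)$.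
   Context: Hashing with coalesced chains. Let $0\le n\le m$ be integers. Items $x_1,\dots,x_n$ are placed sequentially into a table with $m$ cells $1,\dots,m$, using hash addresses $h_1,\dots,h_n\in\{1,\dots,m\}$. Each cell has a link field, initially null. If cell $h_i$ is empty, $x_i$ is inserted there (creating a new chain of length 1). If cell $h_i$ is occupied, $x_i$ is stored in the empty cell $j$ with largest index, and $j$ is linked into the chain containing $h_i$ according to one of two policies: - $\mathsf L$ (late-insertion): follow the links from $h_i$ to the end of the chain (a null link) and append a link there to cell $j$. - $\mathsf E$ (early-insertion): cell $j$ is linked into the chain immediately after $h_i$: if the link from $h_i$ points to $k$ (null or not), this link is reset to $j$, and the link of $j$ is set to $k$. Both policies give the same occupied cells and the same partition of them into chains; only the order within chains may differ. A hash table $\mathcal T$ is encoded by $m$, $n$ and $(h_1,\dots,h_n)$, and both policies are considered together. The random hash table $\mathcal T_{m,n}$ has $m$ cells and $n$ items, with $h_1,\dots,h_n$ i.i.d. uniform on $\{1,\dots,m\}$. For $\Xi\in\{\mathsf L,\mathsf E\}$, $d_i^\Xi(\mathcal T)$ is the final displacement of item $x_i$, i.e. the number of links one has to follow from $h_i$ until $x_i$ is found in the final table (built with policy $\Xi$); $n_k^\Xi(\mathcal T):=\#\{i: d_i^\Xi(\mathcal T)=k\}$; and, if $n>0$, $d^\Xi(\mathcal T):=d_I^\Xi(\mathcal T)$ where $I$ is uniform on $\{1,\dots,n\}$, independent of $\mathcal T$. For an unsuccessful search starting at cell $j$, $d_j^{\mathsf U}(\mathcal T)$ is the number of occupied cells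 encountered: $0$ if cell $j$ is empty, and otherwise $1$ plus the number of cells after $j$ in its chain. Put $n_k^{\mathsf U}(\mathcal T):=\#\{j: d_j^{\mathsf U}(\mathcal T)=k\}$ (the same for both policies) and $d^{\mathsf U}(\mathcal T):=d_J^{\mathsf U}(\mathcal T)$ where $J$ is uniform on $\{1,\dots,m\}$, independent of $\mathcal T$. Limit probabilities, for $\alpha\in[0,1]$: $p^{\mathsf U}_\alpha(0)=1-\alpha$ and $p^{\mathsf U}_\alpha(k)=\int_0^\alpha(1-\alpha+t)(1-e^{-t})^{k-1}\,dt$ for $k\ge1$; $p^{\mathsf L}_\alpha(0)=1-\alpha/2$ and $p^{\mathsf L}_\alpha(k)=\frac1\alpha\int_0^\alpha\bigl(\alpha-t-(\alpha-t)^2/2\bigr)(1-e^{-t})^{k-1}\,dt$ for $k\ge1$; $p^{\mathsf E}_\alpha(0)=1-\alpha/2$ and $p^{\mathsf E}_\alpha(k)=\frac1\alpha\int_0^\alpha(\alpha-t)e^{-t}(1-e^{-t})^{k-1}\,dt$ for $k\ge1$; for $\alpha=0$, $p^{\mathsf L}_0(k)=p^{\mathsf E}_0(k)=0$ when $k\ge1$. *)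

theory Defs
  imports "HOL-Probability.Probability"
begin

section \<open>Hashing with coalesced chains\<close>

datatype policy = Late | Early

text \<open>The cells are the numbers \<open>1, \<dots>, m\<close>, the items \<open>x\<^sub>1, \<dots>, x\<^sub>n\<close> are represented by their indices.
  \<^const>\<open>None\<close> stands for an empty cell in \<open>content\<close> and for a null link in \<open>link\<close>.\<close>

record table =
  content :: "nat \<Rightarrow> nat option"
  link :: "nat \<Rightarrow> nat option"

primrec follow :: "(nat \<Rightarrow> nat option) \<Rightarrow> nat \<Rightarrow> nat \<Rightarrow> nat option" where
  "follow l 0 c = Some c"
| "follow l (Suc d) c = Option.bind (follow l d c) l"

definition chain_end :: "table \<Rightarrow> nat \<Rightarrow> nat" where
  "chain_end T c = (THE e. (\<exists>d. follow (link T) d c = Some e) \<and> link T e = None)"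

definition largest_empty :: "nat \<Rightarrow> table \<Rightarrow> nat" where
  "largest_empty m T = Max {j \<in> {1..m}. content T j = None}"

fun link_cell :: "policy \<Rightarrow> table \<Rightarrow> nat \<Rightarrow> nat \<Rightarrow> nat \<Rightarrow> nat option" where
  "link_cell Late T c j = (link T)(chain_end T c := Some j)"
| "link_cell Early T c j = (link T)(c := Some j, j := link T c)"

definition insert_item :: "policy \<Rightarrow> nat \<Rightarrow> nat \<Rightarrow> nat \<Rightarrow> table \<Rightarrow> table" where
  "insert_item \<Xi> m i c T =
     (if content T c = None then T\<lparr>content := (content T)(c := Some i)\<rparr>
      else let j = largest_empty m T in
        T\<lparr>content := (content T)(j := Some i), link := link_cell \<Xi> T c j\<rparr>)"

primrec build :: "policy \<Rightarrow> nat \<Rightarrow> (nat \<Rightarrow> nat) \<Rightarrow> nat \<Rightarrow> table" where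
  "build \<Xi> m h 0 = \<lparr>content = (\<lambda>_. None), link = (\<lambda>_. None)\<rparr>"
| "build \<Xi> m h (Suc i) = insert_item \<Xi> m (Suc i) (h (Suc i)) (build \<Xi> m h i)"

text \<open>A hash table with \<open>m\<close> cells and \<open>n\<close> items is encoded by \<open>m\<close>, \<open>n\<close> and the hash addresses
  \<open>h 1, \<dots>, h n\<close>.\<close>

definition displacement :: "policy \<Rightarrow> nat \<Rightarrow> nat \<Rightarrow> (nat \<Rightarrow> nat) \<Rightarrow> nat \<Rightarrow> nat" where
  "displacement \<Xi> m n h i =
     (let T = build \<Xi> m h n in
      LEAST d. \<exists>c. follow (link T) d (h i) = Some c \<and> content T c = Some i)"

definition num_displacement :: "policy \<Rightarrow> nat \<Rightarrow> nat \<Rightarrow> (nat \<Rightarrow> nat) \<Rightarrow> nat \<Rightarrow> nat" where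
  "num_displacement \<Xi> m n h k = card {i \<in> {1..n}. displacement \<Xi> m n h i = k}"

text \<open>The individual values of \<open>unsuccessful\<close> depend on the policy; the counts
  \<open>num_unsuccessful\<close> do not. The policy is kept as a parameter throughout.\<close>

definition unsuccessful :: "policy \<Rightarrow> nat \<Rightarrow> nat \<Rightarrow> (nat \<Rightarrow> nat) \<Rightarrow> nat \<Rightarrow> nat" where
  "unsuccessful \<Xi> m n h j =
     (let T = build \<Xi> m h n in
      if content T j = None then 0
      else 1 + card {c. \<exists>d\<ge>1. follow (link T) d j = Some c})"

definition num_unsuccessful :: "policy \<Rightarrow> nat \<Rightarrow> nat \<Rightarrow> (nat \<Rightarrow> nat) \<Rightarrow> nat \<Rightarrow> nat" where
  "num_unsuccessful \<Xi> m n h k = card {j \<in> {1..m}. unsuccessful \<Xi> m n h j = k}"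


section \<open>The random hash table\<close>

text \<open>\<open>h 1, \<dots>, h n\<close> are i.i.d. uniform on \<open>{1..m}\<close>; outside \<open>{1..n}\<close>, \<open>h\<close> has the irrelevant
  value \<open>0\<close>.\<close>

definition random_table :: "nat \<Rightarrow> nat \<Rightarrow> (nat \<Rightarrow> nat) pmf" where
  "random_table m n = Pi_pmf {1..n} 0 (\<lambda>_. pmf_of_set {1..m})"

text \<open>The conditional probabilities given the hash table, as functions of its value \<open>h\<close>. The
  random index is independent of the table, so the joint law is \<^const>\<open>pair_pmf\<close>.\<close>

definition cond_prob_unsuccessful :: "policy \<Rightarrow> nat \<Rightarrow> nat \<Rightarrow> nat \<Rightarrow> (nat \<Rightarrow> nat) \<Rightarrow> real" where
  "cond_prob_unsuccessful \<Xi> m n k h =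
     \<P>(\<omega> in measure_pmf (pair_pmf (random_table m n) (pmf_of_set {1..m})).
        unsuccessful \<Xi> m n (fst \<omega>) (snd \<omega>) = k \<bar> fst \<omega> = h)"

definition cond_prob_displacement :: "policy \<Rightarrow> nat \<Rightarrow> nat \<Rightarrow> nat \<Rightarrow> (nat \<Rightarrow> nat) \<Rightarrow> real" where
  "cond_prob_displacement \<Xi> m n k h =
     \<P>(\<omega> in measure_pmf (pair_pmf (random_table m n) (pmf_of_set {1..n})).
        displacement \<Xi> m n (fst \<omega>) (snd \<omega>) = k \<bar> fst \<omega> = h)"

text \<open>Convergence in probability to a constant; each \<open>X j\<close> may live on its own probability
  space \<open>M j\<close>.\<close>

definition tendsto_in_prob :: "(nat \<Rightarrow> 'a measure) \<Rightarrow> (nat \<Rightarrow> 'a \<Rightarrow> real) \<Rightarrow> real \<Rightarrow> bool" where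
  "tendsto_in_prob M X c \<longleftrightarrow>
     (\<forall>\<epsilon>>0. (\<lambda>j. \<P>(\<omega> in M j. \<bar>X j \<omega> - c\<bar> > \<epsilon>)) \<longlonglongrightarrow> 0)"


section \<open>The limit probabilities\<close>

definition limit_U :: "real \<Rightarrow> nat \<Rightarrow> real" where
  "limit_U \<alpha> k =
     (if k = 0 then 1 - \<alpha>
      else integral {0..\<alpha>} (\<lambda>t. (1 - \<alpha> + t) * (1 - exp (- t)) ^ (k - 1)))"

definition limit_L :: "real \<Rightarrow> nat \<Rightarrow> real" where
  "limit_L \<alpha> k =
     (if k = 0 then 1 - \<alpha> / 2
      else if \<alpha> = 0 then 0
      else 1 / \<alpha> * integral {0..\<alpha>} (\<lambda>t. (\<alpha> - t - (\<alpha> - t)\<^sup>2 / 2) * (1 - exp (- t)) ^ (k - 1)))"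

definition limit_E :: "real \<Rightarrow> nat \<Rightarrow> real" where
  "limit_E \<alpha> k =
     (if k = 0 then 1 - \<alpha> / 2
      else if \<alpha> = 0 then 0
      else 1 / \<alpha> * integral {0..\<alpha>} (\<lambda>t. (\<alpha> - t) * exp (- t) * (1 - exp (- t)) ^ (k - 1)))"

end

theory Submission
  imports Defs
begin

text \<open>
  Let \<open>X\<^sub>i\<close> be one of the counts after \<open>i\<close> insertions. Its increments are bounded, and the expected
  increment given the table is a linear combination of \<open>X\<^sub>i / m\<close> and \<open>Y\<^sub>i / m\<close>, where \<open>Y\<close> is a count that
  has been treated before. If \<open>x\<close> solves the corresponding linear differential equation, then
  \<open>E (X\<^sub>i - m x(i/m))\<^sup>2 = O(i)\<close> by induction over \<open>i\<close>, and Chebyshev's inequality yields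
  convergence in probability. The bound \<open>O(i)\<close>, rather than \<open>O(m)\<close>, makes the argument
  work for \<open>\<alpha> = 0\<close>.

  A chain of length \<open>l\<close> contains exactly one cell at each distance \<open>1, \<dots>, l\<close> from its end, so
  \<open>n\<^sub>k\<^sup>U\<close> is for \<open>k \<ge> 1\<close> the number of chains of length at least \<open>k\<close>. It grows by one when the new
  address hits a chain of length \<open>k - 1\<close> (for \<open>k = 1\<close>, an empty cell). Under late insertion, the
  displacement of a new item is the unsuccessful search length at its address and never changes.
  Under early insertion, the displacement of an item grows by one exactly when a new address falls on
  one of the cells that a search for it traverses before finding it.
\<close>

section \<open>Chains of the table\<close>

text \<open>Table, start cell and item are separate arguments, so that the tables before and after
  one insertion can be compared.\<close>

definition disp :: "table \<Rightarrow> nat \<Rightarrow> nat \<Rightarrow> nat" where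
  "disp T x a = (LEAST d. \<exists>c. follow (link T) d x = Some c \<and> content T c = Some a)"

text \<open>\<open>C b\<close> lists the cells of the chain whose first item was placed in cell \<open>b\<close>, in the order of the
  links; it is empty if no chain started at \<open>b\<close>. The cell \<open>b\<close> serves as a permanent label of the chain.\<close>

locale chain_rep =
  fixes m i :: nat and h :: "nat \<Rightarrow> nat" and T :: table and C :: "nat \<Rightarrow> nat list"
  assumes dist: "distinct (C b)"
    and disj: "y \<in> set (C b) \<Longrightarrow> y \<in> set (C b') \<Longrightarrow> b = b'"
    and root: "C b \<noteq> [] \<Longrightarrow> b \<in> set (C b)"
    and occ: "content T y \<noteq> None \<longleftrightarrow> (\<exists>b. y \<in> set (C b))"
    and cells: "content T y \<noteq> None \<Longrightarrow> y \<in> {1..m}"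
    and link_empty: "content T y = None \<Longrightarrow> link T y = None"
    and link_next: "p < length (C b) \<Longrightarrow>
      link T (C b ! p) = (if Suc p < length (C b) then Some (C b ! Suc p) else None)"
    and content_inj: "content T y = Some a \<Longrightarrow> content T y' = Some a \<Longrightarrow> y = y'"
    and content_le: "content T y = Some a \<Longrightarrow> a \<in> {1..i}"
    and items: "a \<in> {1..i} \<Longrightarrow> \<exists>b p q. p \<le> q \<and> q < length (C b) \<and>
      C b ! p = h a \<and> content T (C b ! q) = Some a"
    and card_occ: "card {y. content T y \<noteq> None} = i"
begin

section \<open>Searching along the list of a chain\<close>

lemma nth_occ: "p < length (C b) \<Longrightarrow> content T (C b ! p) \<noteq> None"
  using occ nth_mem by blast

lemma nth_cells: "p < length (C b) \<Longrightarrow> C b ! p \<in> {1..m}"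
  using cells nth_occ by blast

lemma nth_eqD:
  assumes "C b ! p = C b' ! p'" "p < length (C b)" "p' < length (C b')"
  shows "b = b' \<and> p = p'"
proof -
  have "b = b'" using disj assms nth_mem by metis
  with assms show ?thesis using dist nth_eq_iff_index_eq by blast
qed

lemma occE:
  assumes "content T y \<noteq> None"
  obtains b p where "p < length (C b)" "C b ! p = y"
  using assms occ by (metis in_set_conv_nth)

text \<open>By \<open>link_next\<close> every link advances one position in the list, and past the
  last position \<open>None\<close> is absorbing under \<open>Option.bind\<close>.\<close>

lemma follow_chain:
  "p < length (C b) \<Longrightarrow>
    follow (link T) d (C b ! p) = (if p + d < length (C b) then Some (C b ! (p + d)) else None)"
  by (induction d) (auto simp: link_next)

lemma finite_occ: "finite {y. content T y \<noteq> None}"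
  by (rule finite_subset[of _ "{1..m}"]) (use cells in blast, simp)

lemma roots_finite: "finite {b. C b \<noteq> []}"
proof (rule finite_subset[OF _ finite_occ])
  show "{b. C b \<noteq> []} \<subseteq> {y. content T y \<noteq> None}" using root occ by blast
qed

lemma chains_finite: "0 < k \<Longrightarrow> finite {b. k \<le> length (C b)}"
  by (rule finite_subset[OF _ roots_finite]) auto

text \<open>Within a chain only the last cell has a null link, so the description in
  \<open>chain_end\<close> has a unique solution.\<close>

lemma chain_end_chain:
  assumes "p < length (C b)"
  shows "chain_end T (C b ! p) = C b ! (length (C b) - 1)"
  unfolding chain_end_def
proof (rule the_equality)
  have "follow (link T) (length (C b) - 1 - p) (C b ! p) = Some (C b ! (length (C b) - 1))"
    using assms by (simp add: follow_chain)
  then show "(\<exists>d. follow (link T) d (C b ! p) = Some (C b ! (length (C b) - 1))) \<and>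
      link T (C b ! (length (C b) - 1)) = None"
    using assms by (auto simp: link_next)
next
  fix e assume e: "(\<exists>d. follow (link T) d (C b ! p) = Some e) \<and> link T e = None"
  then obtain d where d: "p + d < length (C b)" "e = C b ! (p + d)"
    using follow_chain[OF assms] by (auto split: if_splits)
  with e have "p + d = length (C b) - 1"
    using link_next[of "p + d" b] by (auto split: if_splits)
  with d show "e = C b ! (length (C b) - 1)" by simp
qed

text \<open>An item lies in at most one cell (\<open>content_inj\<close>) and this cell has only one
  position in the lists, so a single number of links leads to it.\<close>

lemma disp_chain:
  assumes "p \<le> q" "q < length (C b)" "content T (C b ! q) = Some a"
  shows "disp T (C b ! p) a = q - p"
  unfolding disp_def
proof (rule Least_equality)
  show "\<exists>c. follow (link T) (q - p) (C b ! p) = Some c \<and> content T c = Some a"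
    using assms by (simp add: follow_chain)
next
  fix d assume "\<exists>c. follow (link T) d (C b ! p) = Some c \<and> content T c = Some a"
  then have d: "p + d < length (C b)" "content T (C b ! (p + d)) = Some a"
    using assms follow_chain[of p b d] by (auto split: if_splits)
  then have "p + d = q" using nth_eqD[of b "p + d" b q] content_inj assms by blast
  then show "q - p \<le> d" by simp
qed

lemma card_follow_chain:
  assumes "p < length (C b)"
  shows "card {c. \<exists>d\<ge>1. follow (link T) d (C b ! p) = Some c} = length (C b) - Suc p"
proof -
  have "{c. \<exists>d\<ge>1. follow (link T) d (C b ! p) = Some c} = (\<lambda>d. C b ! (p + d)) ` {1..<length (C b) - p}"
    using follow_chain[OF assms] by (fastforce simp: image_iff split: if_splits)
  moreover have "inj_on (\<lambda>d. C b ! (p + d)) {1..<length (C b) - p}"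
  proof (rule inj_onI)
    fix x y assume "x \<in> {1..<length (C b) - p}" "y \<in> {1..<length (C b) - p}"
      "C b ! (p + x) = C b ! (p + y)"
    moreover from this have "p + x < length (C b)" "p + y < length (C b)" by auto
    ultimately show "x = y" using nth_eqD[of b "p + x" b "p + y"] by simp
  qed
  ultimately show ?thesis by (simp add: card_image)
qed

section \<open>Insertion as an operation on the lists\<close>

lemma insert_new:
  assumes c: "content T c = None" "c \<in> {1..m}"
  shows "chain_rep m (Suc i) (h(Suc i := c)) (T\<lparr>content := (content T)(c := Some (Suc i))\<rparr>)
    (C(c := [c]))"
proof -
  \<comment> \<open>The label \<open>c\<close> is still free: by \<open>root\<close>, a nonempty
    list at \<open>c\<close> would make the cell \<open>c\<close> occupied.\<close>
  have Cc: "C c = []" using root occ c by blast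
  have nc: "c \<notin> set (C b)" for b using occ c by blast
  show ?thesis
  proof
    fix a assume a: "a \<in> {1..Suc i}"
    show "\<exists>b p q. p \<le> q \<and> q < length ((C(c := [c])) b) \<and> (C(c := [c])) b ! p = (h(Suc i := c)) a \<and>
      content (T\<lparr>content := (content T)(c := Some (Suc i))\<rparr>) ((C(c := [c])) b ! q) = Some a"
    proof (cases "a = Suc i")
      case True
      then show ?thesis by (intro exI[of _ c] exI[of _ 0]) auto
    next
      case False
      with a obtain b p q where "p \<le> q" "q < length (C b)" "C b ! p = h a" "content T (C b ! q) = Some a"
        using items[of a] by auto
      with False Cc c(1) show ?thesis by (intro exI[of _ b] exI[of _ p] exI[of _ q]) auto
    qed
  next
    have "{y. content (T\<lparr>content := (content T)(c := Some (Suc i))\<rparr>) y \<noteq> None} =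
        insert c {y. content T y \<noteq> None}" by auto
    then show "card {y. content (T\<lparr>content := (content T)(c := Some (Suc i))\<rparr>) y \<noteq> None} = Suc i"
      using finite_occ c card_occ by simp
  next
    fix y a y'
    assume "content (T\<lparr>content := (content T)(c := Some (Suc i))\<rparr>) y = Some a"
       "content (T\<lparr>content := (content T)(c := Some (Suc i))\<rparr>) y' = Some a"
    then show "y = y'" using content_inj content_le[of y a] content_le[of y' a] by (auto split: if_splits)
  next
    fix y a
    assume "content (T\<lparr>content := (content T)(c := Some (Suc i))\<rparr>) y = Some a"
    then show "a \<in> {1..Suc i}" using content_le[of y a] by (auto split: if_splits)
  next
    fix y
    show "(content (T\<lparr>content := (content T)(c := Some (Suc i))\<rparr>) y \<noteq> None) =
         (\<exists>b. y \<in> set ((C(c := [c])) b))"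
    proof (cases "y = c")
      case True
      then show ?thesis by (auto intro!: exI[of _ c])
    next
      case False
      then have "y \<in> set ((C(c := [c])) b) \<longleftrightarrow> y \<in> set (C b)" for b using Cc by auto
      with False show ?thesis using occ[of y] by simp
    qed
  next
    fix b' r assume r: "r < length ((C(c := [c])) b')"
    show "link (T\<lparr>content := (content T)(c := Some (Suc i))\<rparr>) ((C(c := [c])) b' ! r) =
      (if Suc r < length ((C(c := [c])) b') then Some ((C(c := [c])) b' ! Suc r) else None)"
      using r link_next[of r b'] link_empty[OF c(1)] by (auto split: if_splits)
  next
    fix y b1 b2 assume "y \<in> set ((C(c := [c])) b1)" "y \<in> set ((C(c := [c])) b2)"
    then show "b1 = b2" using disj[of y b1 b2] nc by (auto split: if_splits)
  next
    fix y assume "content (T\<lparr>content := (content T)(c := Some (Suc i))\<rparr>) y \<noteq> None"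
    then show "y \<in> {1..m}" using cells[of y] c by (auto split: if_splits)
  next
    fix y assume "content (T\<lparr>content := (content T)(c := Some (Suc i))\<rparr>) y = None"
    then show "link (T\<lparr>content := (content T)(c := Some (Suc i))\<rparr>) y = None"
      using link_empty[of y] by (auto split: if_splits)
  next
    fix b' assume "(C(c := [c])) b' \<noteq> []"
    then show "b' \<in> set ((C(c := [c])) b')" using root[of b'] by (auto split: if_splits)
  next
    fix b' show "distinct ((C(c := [c])) b')" using dist by simp
  qed
qed

text \<open>Serves both policies: \<open>p\<close> is the position of the address and
  \<open>p'\<close> that of the cell after which \<open>j\<close> is linked. The condition
  \<open>p \<le> p'\<close> puts the new item behind its address, as \<open>items\<close>
  demands.\<close>

lemma insert_after:
  assumes j: "content T j = None" "j \<in> {1..m}"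
    and p: "p \<le> p'" "p' < length (C b)"
    and L: "L = take (Suc p') (C b) @ j # drop (Suc p') (C b)"
    and T': "T' = \<lparr>content = (content T)(j := Some (Suc i)),
      link = (link T)(C b ! p' := Some j, j := link T (C b ! p'))\<rparr>"
  shows "chain_rep m (Suc i) (h(Suc i := C b ! p)) T' (C(b := L))"
proof -
  have nj: "j \<notin> set (C b)" for b using occ j by blast
  have lenL: "length L = Suc (length (C b))" using p L by simp
  have setL: "set L = insert j (set (C b))"
    unfolding L using append_take_drop_id[of "Suc p'" "C b"] by (metis list.simps(15) set_append Un_insert_right)
  have distL: "distinct L"
    using dist[of b] nj[of b] append_take_drop_id[of "Suc p'" "C b"] unfolding L
    by (metis distinct.simps(2) distinct_append not_distinct_conv_prefix in_set_takeD in_set_dropD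
      Int_insert_right_if0 list.simps(15))
  have nthL: "L ! r = (if r \<le> p' then C b ! r else if r = Suc p' then j else C b ! (r - 1))"
    if "r < length L" for r
    using p that unfolding L
    by (auto simp: nth_append nth_Cons' min_def) (metis Suc_diff_Suc Suc_lessI diff_Suc_1 diff_Suc_Suc
      numeral_2_eq_2 not_less zero_less_Suc less_trans_Suc Suc_lessD gr0_conv_Suc)
  \<comment> \<open>Position in \<open>L\<close> of the cell that had position \<open>r\<close> in
    \<open>C b\<close>. Since \<open>s\<close> is monotone, no old item gets in front of its
    address.\<close>
  define s where "s r = (if r \<le> p' then r else Suc r)" for r
  have nth_s: "s r < length L" "L ! s r = C b ! r" if "r < length (C b)" for r
    using that nthL[of "s r"] lenL by (auto simp: s_def)
  show ?thesis
  proof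
    fix a assume a: "a \<in> {1..Suc i}"
    show "\<exists>b' p' q. p' \<le> q \<and> q < length ((C(b := L)) b') \<and>
      (C(b := L)) b' ! p' = (h(Suc i := C b ! p)) a \<and> content T' ((C(b := L)) b' ! q) = Some a"
    proof (cases "a = Suc i")
      case True
      then show ?thesis using p nthL[of "Suc p'"] nthL[of p] lenL
        by (intro exI[of _ b] exI[of _ p] exI[of _ "Suc p'"]) (auto simp: T')
    next
      case False
      with a obtain b0 p0 q0 where *: "p0 \<le> q0" "q0 < length (C b0)" "C b0 ! p0 = h a"
        "content T (C b0 ! q0) = Some a"
        using items[of a] by auto
      have "C b0 ! q0 \<noteq> j" using * j by auto
      show ?thesis
      proof (cases "b0 = b")
        case True
        have "s p0 \<le> s q0" using * by (auto simp: s_def)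
        with True * False \<open>C b0 ! q0 \<noteq> j\<close> nth_s[of q0] nth_s[of p0] show ?thesis
          by (intro exI[of _ b] exI[of _ "s p0"] exI[of _ "s q0"]) (auto simp: T')
      next
        case neq: False
        with * False \<open>C b0 ! q0 \<noteq> j\<close> show ?thesis
          by (intro exI[of _ b0] exI[of _ p0] exI[of _ q0]) (auto simp: T')
      qed
    qed
  next
    have "{y. content T' y \<noteq> None} = insert j {y. content T y \<noteq> None}" by (auto simp: T')
    then show "card {y. content T' y \<noteq> None} = Suc i"
      using finite_occ j card_occ by simp
  next
    fix y a y'
    assume "content T' y = Some a" "content T' y' = Some a"
    then show "y = y'" unfolding T' using content_inj content_le[of y a] content_le[of y' a]
      by (auto split: if_splits)
  next
    fix y a
    assume "content T' y = Some a"
    then show "a \<in> {1..Suc i}" unfolding T' using content_le[of y a] by (auto split: if_splits)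
  next
    fix y
    show "(content T' y \<noteq> None) = (\<exists>b'. y \<in> set ((C(b := L)) b'))"
      using occ[of y] setL by (auto simp: T' split: if_splits)
  next
    fix y assume "content T' y = None"
    then show "link T' y = None" unfolding T' using link_empty[of y] nth_occ[of p' b] p by (auto split: if_splits)
  next
    fix y assume "content T' y \<noteq> None"
    then show "y \<in> {1..m}" unfolding T' using cells[of y] j by (auto split: if_splits)
  next
    fix b' show "distinct ((C(b := L)) b')" using distL dist by simp
  next
    fix b' assume "(C(b := L)) b' \<noteq> []"
    moreover have "C b \<noteq> []" using p by auto
    ultimately show "b' \<in> set ((C(b := L)) b')" using root[of b'] setL by (cases "b' = b") auto
  next
    fix y b1 b2 assume "y \<in> set ((C(b := L)) b1)" "y \<in> set ((C(b := L)) b2)"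
    then show "b1 = b2" using disj[of y b1 b2] nj setL by (auto split: if_splits dest: disj)
  next
    fix b' r assume r: "r < length ((C(b := L)) b')"
    show "link T' ((C(b := L)) b' ! r) = (if Suc r < length ((C(b := L)) b') then Some ((C(b := L)) b' ! Suc r) else None)"
    proof (cases "b' = b")
      case False
      then have "C b' ! r \<noteq> C b ! p'" "C b' ! r \<noteq> j"
        using r nth_eqD[of b' r b p'] p nj[of b'] nth_mem[of r "C b'"] by auto
      with False r link_next[of r b'] show ?thesis by (simp add: T')
    next
      case True
      have jp: "C b ! p' \<noteq> j" using nth_mem[of p' "C b"] nj[of b] p by auto
      \<comment> \<open>Only the new cell, at position \<open>Suc p'\<close>, and its predecessor,
        at position \<open>p'\<close>, receive links; every other cell keeps its successor.\<close>
      have eq: "link T' (L ! r) = (if Suc r < length L then Some (L ! Suc r) else None)"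
        if "r = Suc p'"
        using that p r True link_next[of p' b] nthL[of r] nthL[of "Suc r"] lenL
        by (auto simp: T')
      have eq2: "link T' (L ! r) = (if Suc r < length L then Some (L ! Suc r) else None)"
        if "r = p'"
        using that p r True nthL[of r] nthL[of "Suc r"] lenL jp by (auto simp: T')
      have eq3: "link T' (L ! r) = (if Suc r < length L then Some (L ! Suc r) else None)"
        if r': "r \<noteq> p'" "r \<noteq> Suc p'"
      proof -
        \<comment> \<open>The position that the cell \<open>L ! r\<close> had in
          \<open>C b\<close>.\<close>
        define r0 where "r0 = (if r \<le> p' then r else r - 1)"
        have r0: "r0 < length (C b)" "L ! r = C b ! r0" "r0 \<noteq> p'"
          using r r' True nthL[of r] lenL p by (auto simp: r0_def)
        have "C b ! r0 \<noteq> j" using nth_mem[OF r0(1)] nj[of b] by auto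
        moreover have "C b ! r0 \<noteq> C b ! p'" using nth_eqD[of b r0 b p'] r0 p by auto
        moreover have "Suc r < length L \<longleftrightarrow> Suc r0 < length (C b)"
          using r r' p lenL by (auto simp: r0_def)
        moreover have "L ! Suc r = C b ! Suc r0" if "Suc r < length L"
          using that r' p nthL[of "Suc r"] by (auto simp: r0_def)
        ultimately show ?thesis using r0 link_next[of r0 b] by (simp add: T')
      qed
      show ?thesis using eq eq2 eq3 True by (cases "r = p'"; cases "r = Suc p'") simp_all
    qed
  qed
qed


end

section \<open>Search lengths and chain lengths\<close>

definition usearch :: "table \<Rightarrow> nat \<Rightarrow> nat" where
  "usearch T y = (if content T y = None then 0
     else 1 + card {c. \<exists>d\<ge>1. follow (link T) d y = Some c})"

definition ucount :: "nat \<Rightarrow> table \<Rightarrow> nat \<Rightarrow> nat" where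
  "ucount m T k = card {y \<in> {1..m}. usearch T y = k}"

definition search_path :: "table \<Rightarrow> nat \<Rightarrow> nat \<Rightarrow> nat set" where
  "search_path T x a = {c. \<exists>r<disp T x a. follow (link T) r x = Some c}"

text \<open>The position in the chain \<open>xs\<close> after which the new cell is linked when the
  address has position \<open>p\<close>.\<close>

definition insert_pos :: "policy \<Rightarrow> nat list \<Rightarrow> nat \<Rightarrow> nat" where
  "insert_pos \<Xi> xs p = (case \<Xi> of Late \<Rightarrow> length xs - 1 | Early \<Rightarrow> p)"

lemma nth_insert:
  assumes "p < length xs" "r < length xs"
  shows "(take (Suc p) xs @ j # drop (Suc p) xs) ! (if r \<le> p then r else Suc r) = xs ! r"
  using assms by (auto simp: nth_append min_def nth_Cons')

lemma nth_insert_new: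
  assumes "p < length xs"
  shows "(take (Suc p) xs @ j # drop (Suc p) xs) ! Suc p = j"
  using assms by (auto simp: nth_append min_def)

context chain_rep
begin

text \<open>Only \<open>i < m\<close> cells are occupied, so the maximum in
  \<open>largest_empty\<close> is taken over a nonempty set.\<close>

lemma largest_empty:
  assumes "i < m"
  shows "content T (largest_empty m T) = None" "largest_empty m T \<in> {1..m}"
proof -
  have "{j \<in> {1..m}. content T j = None} \<noteq> {}"
  proof
    assume "{j \<in> {1..m}. content T j = None} = {}"
    then have "{1..m} \<subseteq> {y. content T y \<noteq> None}" by (auto simp: set_eq_iff)
    from card_mono[OF finite_occ this] have "m \<le> i" unfolding card_occ by simp
    with assms show False by simp
  qed
  then have "largest_empty m T \<in> {j \<in> {1..m}. content T j = None}"
    unfolding largest_empty_def by (intro Max_in) auto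
  then show "content T (largest_empty m T) = None" "largest_empty m T \<in> {1..m}" by auto
qed

lemma step_new:
  assumes "content T c = None" "c \<in> {1..m}"
  shows "chain_rep m (Suc i) (h(Suc i := c)) (insert_item \<Xi> m (Suc i) c T) (C(c := [c]))"
  using insert_new[OF assms] assms by (simp add: insert_item_def)

lemma content_insert_old:
  "p < length (C b) \<Longrightarrow> content (insert_item \<Xi> m (Suc i) (C b ! p) T) =
    (content T)(largest_empty m T := Some (Suc i))"
  using nth_occ[of p b] by (auto simp: insert_item_def Let_def)

text \<open>Either policy is an instance of \<open>insert_after\<close>, with
  \<open>insert_pos \<Xi> (C b) p\<close> as the position \<open>p'\<close>.\<close>

lemma step_old:
  assumes "i < m" and p: "p < length (C b)"
  shows "chain_rep m (Suc i) (h(Suc i := C b ! p)) (insert_item \<Xi> m (Suc i) (C b ! p) T)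
    (C(b := take (Suc (insert_pos \<Xi> (C b) p)) (C b) @
       largest_empty m T # drop (Suc (insert_pos \<Xi> (C b) p)) (C b)))"
proof (rule insert_after[OF largest_empty[OF \<open>i < m\<close>]])
  let ?j = "largest_empty m T"
  show "p \<le> insert_pos \<Xi> (C b) p" "insert_pos \<Xi> (C b) p < length (C b)"
    using p by (auto simp: insert_pos_def split: policy.split)
  \<comment> \<open>Late insertion does not set the link of the new cell. The general form of
    \<open>insert_after\<close> still applies, because this link and the old link of the last cell
    are both null.\<close>
  have le: "link T ?j = None" using largest_empty[OF \<open>i < m\<close>] link_empty by blast
  have ce: "link T (C b ! (length (C b) - 1)) = None" using p by (simp add: link_next)
  have ne: "?j \<noteq> C b ! (length (C b) - 1)" using largest_empty(1)[OF \<open>i < m\<close>] nth_occ[of "length (C b) - 1" b] p by fastforce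
  show "insert_item \<Xi> m (Suc i) (C b ! p) T =
    \<lparr>content = (content T)(?j := Some (Suc i)),
     link = (link T)(C b ! insert_pos \<Xi> (C b) p := Some ?j, ?j := link T (C b ! insert_pos \<Xi> (C b) p))\<rparr>"
    using nth_occ[OF p] le ce ne
    by (cases \<Xi>; intro table.equality)
      (auto simp: insert_item_def Let_def insert_pos_def chain_end_chain[OF p] fun_eq_iff)
qed (rule refl)

lemma step_ex:
  assumes "i < m" "c \<in> {1..m}"
  shows "\<exists>C'. chain_rep m (Suc i) (h(Suc i := c)) (insert_item \<Xi> m (Suc i) c T) C'"
proof (cases "content T c = None")
  case True
  then show ?thesis using step_new assms by blast
next
  case False
  then obtain b p where "p < length (C b)" "C b ! p = c" by (rule occE)
  then show ?thesis using step_old[OF \<open>i < m\<close>] by blast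
qed

lemma usearch_chain:
  "p < length (C b) \<Longrightarrow> usearch T (C b ! p) = length (C b) - p"
  using nth_occ[of p b] card_follow_chain[of p b] by (auto simp: usearch_def)

lemma usearch_eq_0: "usearch T y = 0 \<longleftrightarrow> content T y = None"
  by (auto simp: usearch_def)

lemma card_usearch_0: "i \<le> m \<Longrightarrow> ucount m T 0 = m - i"
proof -
  have "{y \<in> {1..m}. usearch T y = 0} = {1..m} - {y. content T y \<noteq> None}"
    by (auto simp: usearch_eq_0)
  moreover have "{y. content T y \<noteq> None} \<subseteq> {1..m}" using cells by blast
  ultimately show ?thesis unfolding ucount_def using finite_occ card_occ by (simp add: card_Diff_subset)
qed

text \<open>A chain of length at least \<open>k\<close> is represented by its cell at position
  \<open>length (C b) - k\<close>, from which an unsuccessful search visits exactly \<open>k\<close>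
  cells. The condition \<open>0 < k\<close> keeps this position inside the list.\<close>

lemma card_usearch:
  assumes "0 < k"
  shows "ucount m T k = card {b. k \<le> length (C b)}"
  unfolding ucount_def
proof (rule bij_betw_same_card[symmetric], rule bij_betw_imageI)
  show "inj_on (\<lambda>b. C b ! (length (C b) - k)) {b. k \<le> length (C b)}"
  proof (rule inj_onI)
    fix b b' assume "b \<in> {b. k \<le> length (C b)}" "b' \<in> {b. k \<le> length (C b)}"
      "C b ! (length (C b) - k) = C b' ! (length (C b') - k)"
    then show "b = b'"
      using assms nth_eqD[of b "length (C b) - k" b' "length (C b') - k"] by simp
  qed
  show "(\<lambda>b. C b ! (length (C b) - k)) ` {b. k \<le> length (C b)} = {y \<in> {1..m}. usearch T y = k}"
  proof (intro equalityI subsetI)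
    fix y assume "y \<in> (\<lambda>b. C b ! (length (C b) - k)) ` {b. k \<le> length (C b)}"
    then obtain b where b: "k \<le> length (C b)" "y = C b ! (length (C b) - k)" by auto
    then have "length (C b) - k < length (C b)" using assms by simp
    with b usearch_chain[of "length (C b) - k" b] nth_cells[of "length (C b) - k" b]
    show "y \<in> {y \<in> {1..m}. usearch T y = k}" by simp
  next
    fix y assume y: "y \<in> {y \<in> {1..m}. usearch T y = k}"
    then have "content T y \<noteq> None" using assms usearch_eq_0[of y] by auto
    then obtain b p where p: "p < length (C b)" "C b ! p = y" by (rule occE)
    with y usearch_chain[of p b] have "k = length (C b) - p" by auto
    with p have "k \<le> length (C b)" "y = C b ! (length (C b) - k)" by auto
    then show "y \<in> (\<lambda>b. C b ! (length (C b) - k)) ` {b. k \<le> length (C b)}" by blast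
  qed
qed

text \<open>With value 0 at empty cells, an insertion at \<open>c\<close> always produces a chain of
  length \<open>Suc (chain_len c)\<close>, whether or not \<open>c\<close> is occupied.\<close>

definition chain_len :: "nat \<Rightarrow> nat" where
  "chain_len c = (if content T c = None then 0 else length (C (THE b. c \<in> set (C b))))"

lemma chain_len_nth: "p < length (C b) \<Longrightarrow> chain_len (C b ! p) = length (C b)"
  unfolding chain_len_def using nth_occ[of p b] disj nth_mem[of p "C b"]
  by (metis (mono_tags, lifting) the_equality)

text \<open>Exactly one list grows, by one cell. It joins the lists of length at least
  \<open>k\<close> just when its new length equals \<open>k\<close>.\<close>

lemma usearch_step:
  assumes "i < m" "c \<in> {1..m}" "0 < k"
  shows "ucount m (insert_item \<Xi> m (Suc i) c T) k =
    ucount m T k + of_bool (Suc (chain_len c) = k)"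
proof -
  have *: "card {b'. k \<le> length ((C(b := L)) b')} =
    card {b. k \<le> length (C b)} + of_bool (Suc (length (C b)) = k)"
    if L: "length L = Suc (length (C b))" for b L
  proof (cases "Suc (length (C b)) = k")
    case True
    then have "{b'. k \<le> length ((C(b := L)) b')} = insert b {b. k \<le> length (C b)}" using L by auto
    with True show ?thesis using chains_finite[OF \<open>0 < k\<close>] by simp
  next
    case False
    then have "{b'. k \<le> length ((C(b := L)) b')} = {b. k \<le> length (C b)}" using L by auto
    with False show ?thesis by simp
  qed
  show ?thesis
  proof (cases "content T c = None")
    case True
    then have "C c = []" using root occ by blast
    with True show ?thesis
      unfolding chain_rep.card_usearch[OF step_new[OF True \<open>c \<in> {1..m}\<close>] \<open>0 < k\<close>]
        card_usearch[OF \<open>0 < k\<close>]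
      by (subst *) (simp_all add: chain_len_def)
  next
    case False
    then obtain b p where p: "p < length (C b)" "C b ! p = c" by (rule occE)
    then have len: "length (take (Suc (insert_pos \<Xi> (C b) p)) (C b) @
       largest_empty m T # drop (Suc (insert_pos \<Xi> (C b) p)) (C b)) = Suc (length (C b))"
      by (auto simp: insert_pos_def split: policy.split)
    show ?thesis
      using chain_rep.card_usearch[OF step_old[OF \<open>i < m\<close> p(1), of \<Xi>] \<open>0 < k\<close>] *[OF len]
        card_usearch[OF \<open>0 < k\<close>] chain_len_nth[OF p(1)]
      unfolding p(2) by simp
  qed
qed

text \<open>The difference of the counts is the number of chains of length exactly
  \<open>k - 1\<close>, and each of them contributes its \<open>k - 1\<close> cells. For
  \<open>k = 1\<close> the cells in question are the empty ones, which belong to no chain.\<close>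

lemma card_chain_len:
  assumes "2 \<le> k"
  shows "card {c \<in> {1..m}. Suc (chain_len c) = k} =
    (k - 1) * (ucount m T (k - 1) - ucount m T k)"
proof -
  define B where "B = {b. length (C b) = k - 1}"
  have fin: "finite {b. k - 1 \<le> length (C b)}" using assms by (intro chains_finite) simp
  have finB: "finite B" by (rule finite_subset[OF _ fin]) (simp add: B_def subset_iff)
  have "{c \<in> {1..m}. Suc (chain_len c) = k} = (\<Union>b\<in>B. set (C b))"
  proof (intro equalityI subsetI)
    fix c assume c: "c \<in> {c \<in> {1..m}. Suc (chain_len c) = k}"
    then have "content T c \<noteq> None" using assms by (intro notI) (simp add: chain_len_def)
    then obtain b p where p: "p < length (C b)" "C b ! p = c" by (rule occE)
    with c chain_len_nth[OF p(1)] have "b \<in> B" by (auto simp: B_def)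
    then show "c \<in> (\<Union>b\<in>B. set (C b))" using p nth_mem by blast
  next
    fix c assume "c \<in> (\<Union>b\<in>B. set (C b))"
    then obtain b p where "b \<in> B" "p < length (C b)" "C b ! p = c" by (auto simp: in_set_conv_nth)
    then show "c \<in> {c \<in> {1..m}. Suc (chain_len c) = k}"
      using chain_len_nth[of p b] nth_cells[of p b] assms by (auto simp: B_def)
  qed
  then have "card {c \<in> {1..m}. Suc (chain_len c) = k} = (\<Sum>b\<in>B. card (set (C b)))"
    using finB disj by (simp only:) (rule card_UN_disjoint; blast)
  also have "\<dots> = card B * (k - 1)"
    using dist by (simp add: distinct_card B_def)
  also have "card B = card {b. k - 1 \<le> length (C b)} - card {b. k \<le> length (C b)}"
  proof -
    have "B = {b. k - 1 \<le> length (C b)} - {b. k \<le> length (C b)}" using assms by (auto simp: B_def)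
    moreover have "{b. k \<le> length (C b)} \<subseteq> {b. k - 1 \<le> length (C b)}" by auto
    ultimately show ?thesis using card_Diff_subset[of "{b. k \<le> length (C b)}"] chains_finite[of k] assms
      by simp
  qed
  finally show ?thesis using assms by (simp add: card_usearch)
qed

text \<open>Ensures that the natural subtraction in \<open>card_chain_len\<close> is a true
  difference.\<close>

lemma card_usearch_mono:
  assumes "2 \<le> k"
  shows "ucount m T k \<le> ucount m T (k - 1)"
proof -
  have "{b. k \<le> length (C b)} \<subseteq> {b. k - 1 \<le> length (C b)}" by auto
  then have "card {b. k \<le> length (C b)} \<le> card {b. k - 1 \<le> length (C b)}"
    using assms by (intro card_mono chains_finite) auto
  then show ?thesis using assms by (simp add: card_usearch)
qed


section \<open>Search paths and displacements under insertion\<close>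

lemma search_path_chain:
  assumes "p \<le> q" "q < length (C b)" "content T (C b ! q) = Some a"
  shows "search_path T (C b ! p) a = (!) (C b) ` {p..<q}"
proof -
  have "search_path T (C b ! p) a = {c. \<exists>r<q - p. C b ! (p + r) = c}"
    unfolding search_path_def disp_chain[OF assms] using assms
    by (intro Collect_cong ex_cong1) (auto simp: follow_chain)
  also have "\<dots> = (!) (C b) ` {p..<q}"
  proof (intro equalityI subsetI)
    fix c assume "c \<in> (!) (C b) ` {p..<q}"
    then obtain s where "p \<le> s" "s < q" "c = C b ! s" by auto
    then show "c \<in> {c. \<exists>r<q - p. C b ! (p + r) = c}" by (auto intro!: exI[of _ "s - p"])
  qed (auto simp: less_diff_conv add.commute)
  finally show ?thesis .
qed

lemma card_search_path: "a \<in> {1..i} \<Longrightarrow> card (search_path T (h a) a) = disp T (h a) a"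
proof -
  assume "a \<in> {1..i}"
  then obtain b p q where *: "p \<le> q" "q < length (C b)" "C b ! p = h a" "content T (C b ! q) = Some a"
    using items by blast
  have "inj_on ((!) (C b)) {p..<q}" using dist[of b] *(2) by (intro inj_on_nth) auto
  then show ?thesis
    using search_path_chain[OF *(1,2,4)] disp_chain[OF *(1,2,4)] by (simp add: *(3) card_image)
qed

lemma search_path_occ: "a \<in> {1..i} \<Longrightarrow> c \<in> search_path T (h a) a \<Longrightarrow> content T c \<noteq> None"
proof -
  assume "a \<in> {1..i}" and c: "c \<in> search_path T (h a) a"
  then obtain b p q where *: "p \<le> q" "q < length (C b)" "C b ! p = h a" "content T (C b ! q) = Some a"
    using items by blast
  have "c \<in> (!) (C b) ` {p..<q}" using c search_path_chain[OF *(1,2,4)] *(3) by simp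
  then obtain r where "r < q" "c = C b ! r" by auto
  with *(2) have "r < length (C b)" "c = C b ! r" by auto
  then show ?thesis using nth_occ by blast
qed

text \<open>If a search of length \<open>k\<close> passes \<open>c\<close>, it starts at one of the
  \<open>k\<close> last positions up to and including that of \<open>c\<close>. The start determines
  the item, which lies \<open>k\<close> places further. This bounds the increments under early
  insertion.\<close>

lemma card_items_through:
  "card {a \<in> {1..i}. disp T (h a) a = k \<and> c \<in> search_path T (h a) a} \<le> k"
proof (cases "content T c = None")
  case True
  then have "{a \<in> {1..i}. disp T (h a) a = k \<and> c \<in> search_path T (h a) a} = {}" using search_path_occ by blast
  then show ?thesis by (simp only: card.empty)
next
  case False
  then obtain b s where s: "s < length (C b)" "C b ! s = c" by (rule occE)
  \<comment> \<open>Here \<open>s\<close> is the position of \<open>c\<close> and \<open>r\<close>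
    the distance from the address to \<open>c\<close>, so the item has position
    \<open>s + k - r\<close>.\<close>
  have "{a \<in> {1..i}. disp T (h a) a = k \<and> c \<in> search_path T (h a) a} \<subseteq>
    (\<lambda>r. the (content T (C b ! (s + k - r)))) ` {..<k}"
  proof
    fix a assume a: "a \<in> {a \<in> {1..i}. disp T (h a) a = k \<and> c \<in> search_path T (h a) a}"
    then obtain b' p q where *: "p \<le> q" "q < length (C b')" "C b' ! p = h a" "content T (C b' ! q) = Some a"
      using items[of a] by auto
    have k: "k = q - p" using a disp_chain[OF *(1,2,4)] *(3) by simp
    have "c \<in> (!) (C b') ` {p..<q}" using a search_path_chain[OF *(1,2,4)] *(3) by simp
    then obtain r where r: "p \<le> r" "r < q" "c = C b' ! r" by auto
    then have "b' = b \<and> r = s" using nth_eqD[of b' r b s] s * by simp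
    with r k * have "a = the (content T (C b ! (s + k - (s - p))))" "s - p < k" by auto
    then show "a \<in> (\<lambda>r. the (content T (C b ! (s + k - r)))) ` {..<k}" by blast
  qed
  from surj_card_le[OF _ this] show ?thesis by simp
qed

lemma disp_step_new:
  assumes "content T c = None" "c \<in> {1..m}"
  shows "a \<in> {1..i} \<Longrightarrow> disp (insert_item \<Xi> m (Suc i) c T) (h a) a = disp T (h a) a"
    and "disp (insert_item \<Xi> m (Suc i) c T) c (Suc i) = 0"
proof -
  interpret new: chain_rep m "Suc i" "h(Suc i := c)" "insert_item \<Xi> m (Suc i) c T" "C(c := [c])"
    using step_new[OF assms] .
  have ct: "content (insert_item \<Xi> m (Suc i) c T) = (content T)(c := Some (Suc i))"
    using assms by (simp add: insert_item_def)
  show "disp (insert_item \<Xi> m (Suc i) c T) c (Suc i) = 0"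
    using new.disp_chain[of 0 0 c "Suc i"] ct by simp
  assume "a \<in> {1..i}"
  then obtain b p q where *: "p \<le> q" "q < length (C b)" "C b ! p = h a" "content T (C b ! q) = Some a"
    using items by blast
  have "C c = []" using root occ assms by blast
  then have "b \<noteq> c" using * by auto
  moreover have "C b ! q \<noteq> c" using * assms by auto
  ultimately show "disp (insert_item \<Xi> m (Suc i) c T) (h a) a = disp T (h a) a"
    using new.disp_chain[of p q b a] * ct disp_chain[OF *(1,2,4)] by simp
qed

text \<open>An old item moves one link away from its address exactly when the new cell is linked in
  between, that is, after a position not before the address and strictly before the item. The new
  item gets position \<open>Suc (insert_pos \<Xi> (C b) p)\<close>.\<close>

lemma disp_step_old:
  assumes "i < m" and p: "p < length (C b)"
  shows "\<lbrakk>p0 \<le> q; q < length (C b'); C b' ! p0 = h a; content T (C b' ! q) = Some a\<rbrakk> \<Longrightarrow>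
      disp (insert_item \<Xi> m (Suc i) (C b ! p) T) (h a) a = disp T (h a) a +
        of_bool (b' = b \<and> p0 \<le> insert_pos \<Xi> (C b) p \<and> insert_pos \<Xi> (C b) p < q)"
    and "disp (insert_item \<Xi> m (Suc i) (C b ! p) T) (C b ! p) (Suc i) = Suc (insert_pos \<Xi> (C b) p) - p"
proof -
  let ?T = "insert_item \<Xi> m (Suc i) (C b ! p) T"
  define p' where "p' = insert_pos \<Xi> (C b) p"
  define j where "j = largest_empty m T"
  define L where "L = take (Suc p') (C b) @ j # drop (Suc p') (C b)"
  interpret new: chain_rep m "Suc i" "h(Suc i := C b ! p)" ?T "C(b := L)"
    using step_old[OF assms, of \<Xi>] by (simp add: L_def p'_def j_def)
  have p': "p \<le> p'" "p' < length (C b)"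
    using p by (auto simp: p'_def insert_pos_def split: policy.split)
  have lenL: "length L = Suc (length (C b))" using p' by (simp add: L_def)
  have ct: "content ?T = (content T)(j := Some (Suc i))"
    using content_insert_old[OF p, of \<Xi>] by (simp add: j_def)
  have je: "content T j = None" using largest_empty(1)[OF \<open>i < m\<close>] by (simp add: j_def)
  have Lj: "L ! Suc p' = j" unfolding L_def using p' by (intro nth_insert_new) auto
  have Ls: "L ! (if r \<le> p' then r else Suc r) = C b ! r" if "r < length (C b)" for r
    unfolding L_def using p' that by (intro nth_insert) auto
  have Lp: "L ! p = C b ! p" using Ls[OF p] p' by simp
  show "disp ?T (C b ! p) (Suc i) = Suc (insert_pos \<Xi> (C b) p) - p"
    using new.disp_chain[of p "Suc p'" b "Suc i"] p' lenL ct Lj Lp by (simp add: p'_def)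
  assume *: "p0 \<le> q" "q < length (C b')" "C b' ! p0 = h a" "content T (C b' ! q) = Some a"
  have nj: "C b' ! q \<noteq> j" using * je by auto
  show "disp ?T (h a) a = disp T (h a) a +
        of_bool (b' = b \<and> p0 \<le> insert_pos \<Xi> (C b) p \<and> insert_pos \<Xi> (C b) p < q)"
  proof (cases "b' = b")
    case False
    then show ?thesis using new.disp_chain[of p0 q b' a] * ct nj disp_chain[OF *(1,2,4)] by simp
  next
    case True
    \<comment> \<open>Old positions translated into positions in \<open>L\<close>: all cells behind
      \<open>p'\<close> move by one.\<close>
    let ?s = "\<lambda>r. if r \<le> p' then r else Suc r"
    have "?s p0 \<le> ?s q" "?s q < length L" using * lenL True by auto
    moreover have "L ! ?s q = C b ! q" "L ! ?s p0 = C b ! p0" using Ls[of q] Ls[of p0] * True by auto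
    ultimately have "disp ?T (h a) a = ?s q - ?s p0"
      using new.disp_chain[of "?s p0" "?s q" b a] * True ct nj by simp
    then show ?thesis using disp_chain[OF *(1,2,4)] * True by (auto simp: p'_def)
  qed
qed

text \<open>The new cell comes last, so it separates no old item from its address. The number of
  links to it is the number of old cells from the address to the end of the chain.\<close>

lemma disp_step_Late:
  assumes "i < m" "c \<in> {1..m}"
  shows "a \<in> {1..i} \<Longrightarrow> disp (insert_item Late m (Suc i) c T) (h a) a = disp T (h a) a"
    and "disp (insert_item Late m (Suc i) c T) c (Suc i) = usearch T c"
proof -
  have "(a \<in> {1..i} \<longrightarrow> disp (insert_item Late m (Suc i) c T) (h a) a = disp T (h a) a) \<and>
    disp (insert_item Late m (Suc i) c T) c (Suc i) = usearch T c"
  proof (cases "content T c = None")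
    case True
    then show ?thesis using disp_step_new[OF True \<open>c \<in> {1..m}\<close>] usearch_eq_0[of c] by simp
  next
    case False
    then obtain b p where p: "p < length (C b)" "C b ! p = c" by (rule occE)
    have "disp (insert_item Late m (Suc i) c T) (h a) a = disp T (h a) a" if "a \<in> {1..i}"
    proof -
      obtain b' p0 q where *: "p0 \<le> q" "q < length (C b')" "C b' ! p0 = h a" "content T (C b' ! q) = Some a"
        using items[OF \<open>a \<in> {1..i}\<close>] by blast
      show ?thesis using disp_step_old(1)[OF \<open>i < m\<close> p(1) *, of Late] p *(2) by (auto simp: insert_pos_def)
    qed
    then show ?thesis using disp_step_old(2)[OF \<open>i < m\<close> p(1), of Late] usearch_chain[OF p(1)] p
      by (auto simp: insert_pos_def)
  qed
  then show "a \<in> {1..i} \<Longrightarrow> disp (insert_item Late m (Suc i) c T) (h a) a = disp T (h a) a"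
    and "disp (insert_item Late m (Suc i) c T) c (Suc i) = usearch T c" by blast+
qed

text \<open>The new cell directly follows its address, so by \<open>disp_step_old\<close> it delays
  just the searches that pass this address. The new item itself is one link away, or none if the
  address was empty.\<close>

lemma disp_step_Early:
  assumes "i < m" "c \<in> {1..m}"
  shows "a \<in> {1..i} \<Longrightarrow> disp (insert_item Early m (Suc i) c T) (h a) a =
      disp T (h a) a + of_bool (c \<in> search_path T (h a) a)"
    and "disp (insert_item Early m (Suc i) c T) c (Suc i) = of_bool (content T c \<noteq> None)"
proof -
  have "(a \<in> {1..i} \<longrightarrow> disp (insert_item Early m (Suc i) c T) (h a) a =
      disp T (h a) a + of_bool (c \<in> search_path T (h a) a)) \<and>
    disp (insert_item Early m (Suc i) c T) c (Suc i) = of_bool (content T c \<noteq> None)"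
  proof (cases "content T c = None")
    case True
    then show ?thesis using disp_step_new[OF True \<open>c \<in> {1..m}\<close>] search_path_occ[of a c] by auto
  next
    case False
    then obtain b p where p: "p < length (C b)" "C b ! p = c" by (rule occE)
    have "disp (insert_item Early m (Suc i) c T) (h a) a = disp T (h a) a + of_bool (c \<in> search_path T (h a) a)"
      if "a \<in> {1..i}"
    proof -
      obtain b' p0 q where *: "p0 \<le> q" "q < length (C b')" "C b' ! p0 = h a" "content T (C b' ! q) = Some a"
        using items[OF \<open>a \<in> {1..i}\<close>] by blast
      have "c \<in> search_path T (h a) a \<longleftrightarrow> c \<in> (!) (C b') ` {p0..<q}"
        using search_path_chain[OF *(1,2,4)] *(3) by simp
      also have "\<dots> \<longleftrightarrow> b' = b \<and> p0 \<le> p \<and> p < q"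
      proof
        assume "c \<in> (!) (C b') ` {p0..<q}"
        then obtain r where "p0 \<le> r" "r < q" "c = C b' ! r" by auto
        then show "b' = b \<and> p0 \<le> p \<and> p < q" using nth_eqD[of b' r b p] p * by auto
      qed (use p in auto)
      finally show ?thesis using disp_step_old(1)[OF \<open>i < m\<close> p(1) *, of Early] p by (simp add: insert_pos_def)
    qed
    then show ?thesis using disp_step_old(2)[OF \<open>i < m\<close> p(1), of Early] p False
      by (simp add: insert_pos_def)
  qed
  then show "a \<in> {1..i} \<Longrightarrow> disp (insert_item Early m (Suc i) c T) (h a) a =
      disp T (h a) a + of_bool (c \<in> search_path T (h a) a)"
    and "disp (insert_item Early m (Suc i) c T) c (Suc i) = of_bool (content T c \<noteq> None)" by blast+
qed

end


section \<open>Increments of the counts in one insertion\<close>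

lemma displacement_eq: "displacement \<Xi> m n h a = disp (build \<Xi> m h n) (h a) a"
  by (simp add: displacement_def disp_def Let_def)

lemma num_unsuccessful_eq: "num_unsuccessful \<Xi> m n h k = ucount m (build \<Xi> m h n) k"
  by (simp add: num_unsuccessful_def ucount_def unsuccessful_def usearch_def Let_def)

text \<open>Allows the next address to be chosen freely without affecting the table already
  built.\<close>

lemma build_cong: "(\<And>a. a \<in> {1..i} \<Longrightarrow> h a = h' a) \<Longrightarrow> build \<Xi> m h i = build \<Xi> m h' i"
  by (induction i) auto

lemma build_step: "build \<Xi> m (h(Suc i := c)) (Suc i) = insert_item \<Xi> m (Suc i) c (build \<Xi> m h i)"
  using build_cong[of i "h(Suc i := c)" h] by simp

lemma chain_rep_build:
  assumes "i \<le> m" "\<And>a. a \<in> {1..i} \<Longrightarrow> h a \<in> {1..m}"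
  shows "\<exists>C. chain_rep m i h (build \<Xi> m h i) C"
  using assms
proof (induction i)
  case 0
  have "chain_rep m 0 h (build \<Xi> m h 0) (\<lambda>_. [])" by unfold_locales auto
  then show ?case by blast
next
  case (Suc i)
  then obtain C where "chain_rep m i h (build \<Xi> m h i) C" by fastforce
  from chain_rep.step_ex[OF this, of "h (Suc i)" \<Xi>] Suc.prems show ?case by auto
qed

context
  fixes m i :: nat and h :: "nat \<Rightarrow> nat"
  assumes valid: "\<And>a. a \<in> {1..i} \<Longrightarrow> h a \<in> {1..m}"
begin

lemma build_represented: "i \<le> m \<Longrightarrow> \<exists>C. chain_rep m i h (build \<Xi> m h i) C"
  using chain_rep_build[of i m h] valid by blast

lemma num_unsuccessful_0:
  assumes "i \<le> m"
  shows "num_unsuccessful \<Xi> m i h 0 = m - i"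
proof -
  obtain C where "chain_rep m i h (build \<Xi> m h i) C" using build_represented[OF assms] by blast
  from chain_rep.card_usearch_0[OF this assms] show ?thesis by (simp add: num_unsuccessful_eq)
qed

text \<open>The next address is uniform, so the sum over \<open>c\<close> is \<open>m\<close> times
  the mean increment given the table. The two parts supply the hypotheses \<open>bounded\<close> and
  \<open>drift\<close> of \<open>tracks_step\<close>.\<close>

lemma num_unsuccessful_step:
  assumes "i < m" "0 < k"
  shows "c \<in> {1..m} \<Longrightarrow> \<bar>real (num_unsuccessful \<Xi> m (Suc i) (h(Suc i := c)) k) -
      real (num_unsuccessful \<Xi> m i h k)\<bar> \<le> 1"
    and "(\<Sum>c\<in>{1..m}. real (num_unsuccessful \<Xi> m (Suc i) (h(Suc i := c)) k) -
      real (num_unsuccessful \<Xi> m i h k)) =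
      (if k = 1 then real (num_unsuccessful \<Xi> m i h 0)
       else real (k - 1) * (real (num_unsuccessful \<Xi> m i h (k - 1)) - real (num_unsuccessful \<Xi> m i h k)))"
proof -
  obtain C where "chain_rep m i h (build \<Xi> m h i) C"
    using build_represented[OF less_imp_le[OF \<open>i < m\<close>]] by blast
  then interpret chain_rep m i h "build \<Xi> m h i" C .
  have step: "real (num_unsuccessful \<Xi> m (Suc i) (h(Suc i := c)) k) - real (num_unsuccessful \<Xi> m i h k)
    = of_bool (Suc (chain_len c) = k)" if "c \<in> {1..m}" for c
    unfolding num_unsuccessful_eq build_step usearch_step[OF \<open>i < m\<close> that \<open>0 < k\<close>] by simp
  show "c \<in> {1..m} \<Longrightarrow> \<bar>real (num_unsuccessful \<Xi> m (Suc i) (h(Suc i := c)) k) -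
      real (num_unsuccessful \<Xi> m i h k)\<bar> \<le> 1"
    by (subst step) auto
  have "(\<Sum>c\<in>{1..m}. real (num_unsuccessful \<Xi> m (Suc i) (h(Suc i := c)) k) -
      real (num_unsuccessful \<Xi> m i h k)) = (\<Sum>c\<in>{1..m}. of_bool (Suc (chain_len c) = k))"
    by (rule sum.cong[OF refl step])
  also have "\<dots> = real (card {c \<in> {1..m}. Suc (chain_len c) = k})"
    by (simp add: sum.If_cases of_bool_def Int_def)
  also have "\<dots> = (if k = 1 then real (num_unsuccessful \<Xi> m i h 0)
       else real (k - 1) * (real (num_unsuccessful \<Xi> m i h (k - 1)) - real (num_unsuccessful \<Xi> m i h k)))"
  proof (cases "k = 1")
    case True
    \<comment> \<open>For \<open>k = 1\<close> a new chain arises at an empty cell, and both lengths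
      vanish exactly there.\<close>
    have "chain_len c = 0 \<longleftrightarrow> usearch (build \<Xi> m h i) c = 0" for c
    proof (cases "content (build \<Xi> m h i) c = None")
      case False
      then obtain b p where p: "p < length (C b)" "C b ! p = c" by (rule occE)
      then show ?thesis using chain_len_nth[OF p(1)] usearch_chain[OF p(1)] by auto
    qed (simp add: chain_len_def usearch_def)
    with True show ?thesis by (simp add: num_unsuccessful_eq ucount_def)
  next
    case False
    then have "2 \<le> k" using \<open>0 < k\<close> by simp
    then show ?thesis using False card_usearch_mono[of k]
      unfolding card_chain_len[OF \<open>2 \<le> k\<close>] num_unsuccessful_eq by (simp add: of_nat_diff)
  qed
  finally show "(\<Sum>c\<in>{1..m}. real (num_unsuccessful \<Xi> m (Suc i) (h(Suc i := c)) k) -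
      real (num_unsuccessful \<Xi> m i h k)) =
      (if k = 1 then real (num_unsuccessful \<Xi> m i h 0)
       else real (k - 1) * (real (num_unsuccessful \<Xi> m i h (k - 1)) - real (num_unsuccessful \<Xi> m i h k)))" .
qed

lemma num_displacement_Suc:
  "num_displacement \<Xi> m (Suc i) (h(Suc i := c)) k =
    card {a \<in> {1..i}. disp (insert_item \<Xi> m (Suc i) c (build \<Xi> m h i)) (h a) a = k} +
    of_bool (disp (insert_item \<Xi> m (Suc i) c (build \<Xi> m h i)) c (Suc i) = k)"
proof -
  let ?T = "insert_item \<Xi> m (Suc i) c (build \<Xi> m h i)"
  let ?A = "{a \<in> {1..i}. disp ?T (h a) a = k}"
  have "{a \<in> {1..Suc i}. disp ?T ((h(Suc i := c)) a) a = k} =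
    (if disp ?T c (Suc i) = k then insert (Suc i) ?A else ?A)"
    by (auto simp: le_Suc_eq)
  then show ?thesis unfolding num_displacement_def displacement_eq build_step by simp
qed

text \<open>Old displacements never change, so the increment comes from the new item alone, whose
  displacement is the unsuccessful search length at its address.\<close>

lemma num_displacement_Late_step:
  assumes "i < m"
  shows "c \<in> {1..m} \<Longrightarrow> \<bar>real (num_displacement Late m (Suc i) (h(Suc i := c)) k) -
      real (num_displacement Late m i h k)\<bar> \<le> 1"
    and "(\<Sum>c\<in>{1..m}. real (num_displacement Late m (Suc i) (h(Suc i := c)) k) -
      real (num_displacement Late m i h k)) = real (num_unsuccessful Late m i h k)"
proof -
  obtain C where "chain_rep m i h (build Late m h i) C"
    using build_represented[OF less_imp_le[OF \<open>i < m\<close>]] by blast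
  then interpret chain_rep m i h "build Late m h i" C .
  have step: "real (num_displacement Late m (Suc i) (h(Suc i := c)) k) - real (num_displacement Late m i h k)
    = of_bool (usearch (build Late m h i) c = k)" if "c \<in> {1..m}" for c
  proof -
    have "{a \<in> {1..i}. disp (insert_item Late m (Suc i) c (build Late m h i)) (h a) a = k} =
      {a \<in> {1..i}. displacement Late m i h a = k}"
      using disp_step_Late(1)[OF \<open>i < m\<close> that] by (auto simp: displacement_eq)
    then show ?thesis
      unfolding num_displacement_Suc disp_step_Late(2)[OF \<open>i < m\<close> that] by (simp add: num_displacement_def)
  qed
  show "c \<in> {1..m} \<Longrightarrow> \<bar>real (num_displacement Late m (Suc i) (h(Suc i := c)) k) -
      real (num_displacement Late m i h k)\<bar> \<le> 1"
    by (subst step) auto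
  have "(\<Sum>c\<in>{1..m}. real (num_displacement Late m (Suc i) (h(Suc i := c)) k) -
      real (num_displacement Late m i h k)) = (\<Sum>c\<in>{1..m}. of_bool (usearch (build Late m h i) c = k))"
    by (rule sum.cong[OF refl step])
  then show "(\<Sum>c\<in>{1..m}. real (num_displacement Late m (Suc i) (h(Suc i := c)) k) -
      real (num_displacement Late m i h k)) = real (num_unsuccessful Late m i h k)"
    by (simp add: num_unsuccessful_eq ucount_def sum.If_cases of_bool_def Int_def)
qed

text \<open>An item of displacement \<open>d\<close> is moved to \<open>d + 1\<close> by exactly the
  \<open>d\<close> addresses on its search path. So level \<open>k\<close> loses \<open>k\<close>
  times its own count and gains \<open>k - 1\<close> times the count below. The new item adds the
  empty cells to level 0 and the \<open>i\<close> occupied cells to level 1.\<close>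

lemma num_displacement_Early_step:
  assumes "i < m"
  shows "c \<in> {1..m} \<Longrightarrow> \<bar>real (num_displacement Early m (Suc i) (h(Suc i := c)) k) -
      real (num_displacement Early m i h k)\<bar> \<le> real k + 1"
    and "(\<Sum>c\<in>{1..m}. real (num_displacement Early m (Suc i) (h(Suc i := c)) k) -
      real (num_displacement Early m i h k)) =
      (if k = 0 then real (num_unsuccessful Early m i h 0)
       else (if k = 1 then real i else real (k - 1) * real (num_displacement Early m i h (k - 1)))
         - real k * real (num_displacement Early m i h k))"
proof -
  let ?T = "build Early m h i"
  define D where "D a = disp ?T (h a) a" for a
  define P where "P a = search_path ?T (h a) a" for a
  obtain C where "chain_rep m i h ?T C"
    using build_represented[OF less_imp_le[OF \<open>i < m\<close>]] by blast
  then interpret chain_rep m i h ?T C .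
  have N: "num_displacement Early m i h k = card {a \<in> {1..i}. D a = k}" for k
    by (simp add: num_displacement_def displacement_eq D_def)
  have step: "num_displacement Early m (Suc i) (h(Suc i := c)) k =
    card {a \<in> {1..i}. D a + of_bool (c \<in> P a) = k} + of_bool (of_bool (content ?T c \<noteq> None) = k)"
    if "c \<in> {1..m}" for c
  proof -
    have "{a \<in> {1..i}. disp (insert_item Early m (Suc i) c ?T) (h a) a = k} =
      {a \<in> {1..i}. D a + of_bool (c \<in> P a) = k}"
      using disp_step_Early(1)[OF \<open>i < m\<close> that] by (auto simp: D_def P_def)
    then show ?thesis
      unfolding num_displacement_Suc disp_step_Early(2)[OF \<open>i < m\<close> that] by simp
  qed
  have through: "card {a \<in> {1..i}. D a = k \<and> c \<in> P a} \<le> k" for c k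
    using card_items_through[of k c] by (simp add: D_def P_def)
  have Pm: "P a \<subseteq> {1..m}" if "a \<in> {1..i}" for a
    using search_path_occ[OF that] cells by (auto simp: P_def)
  have cardP: "card (P a) = D a" if "a \<in> {1..i}" for a
    using card_search_path[OF that] by (simp add: P_def D_def)
  show "\<bar>real (num_displacement Early m (Suc i) (h(Suc i := c)) k) -
      real (num_displacement Early m i h k)\<bar> \<le> real k + 1" if c: "c \<in> {1..m}"
  proof -
    \<comment> \<open>Items enter level \<open>k\<close> only from level \<open>k - 1\<close> and
      leave it only if their search passes \<open>c\<close>; \<open>card_items_through\<close>
      bounds both numbers by \<open>k\<close>. For \<open>k = 0\<close>, where \<open>k - 1\<close>
      is again 0, the superset is merely larger.\<close>
    have "card {a \<in> {1..i}. D a + of_bool (c \<in> P a) = k} \<le>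
      card ({a \<in> {1..i}. D a = k} \<union> {a \<in> {1..i}. D a = k - 1 \<and> c \<in> P a})"
      by (intro card_mono) auto
    also have "\<dots> \<le> card {a \<in> {1..i}. D a = k} + k"
      using card_Un_le[of "{a \<in> {1..i}. D a = k}" "{a \<in> {1..i}. D a = k - 1 \<and> c \<in> P a}"]
        through[of "k - 1" c] by linarith
    finally have 1: "card {a \<in> {1..i}. D a + of_bool (c \<in> P a) = k} \<le> card {a \<in> {1..i}. D a = k} + k" .
    have "card {a \<in> {1..i}. D a = k} \<le>
      card ({a \<in> {1..i}. D a + of_bool (c \<in> P a) = k} \<union> {a \<in> {1..i}. D a = k \<and> c \<in> P a})"
      by (intro card_mono) auto
    also have "\<dots> \<le> card {a \<in> {1..i}. D a + of_bool (c \<in> P a) = k} + k"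
      using card_Un_le[of "{a \<in> {1..i}. D a + of_bool (c \<in> P a) = k}" "{a \<in> {1..i}. D a = k \<and> c \<in> P a}"]
        through[of k c] by linarith
    finally have 2: "card {a \<in> {1..i}. D a = k} \<le> card {a \<in> {1..i}. D a + of_bool (c \<in> P a) = k} + k" .
    show ?thesis unfolding step[OF c] N using 1 2 by (simp add: abs_le_iff)
  qed
  \<comment> \<open>For a fixed item, \<open>D a\<close> of the \<open>m\<close> addresses lie on
    its search path and raise its displacement by one; the others leave it alone. Summing over
    addresses before items then gives the total.\<close>
  have sum_a: "(\<Sum>c\<in>{1..m}. of_bool (D a + of_bool (c \<in> P a) = k)) =
    of_bool (D a = k) * (real m - real k) + of_bool (Suc (D a) = k) * (real k - 1)"
    if a: "a \<in> {1..i}" for a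
  proof -
    have finP: "finite (P a)" using Pm[OF a] finite_subset by blast
    have "(\<Sum>c\<in>{1..m}. of_bool (D a + of_bool (c \<in> P a) = k)) =
      (\<Sum>c\<in>{1..m} - P a. of_bool (D a + of_bool (c \<in> P a) = k)) +
      (\<Sum>c\<in>P a. of_bool (D a + of_bool (c \<in> P a) = k) :: real)"
      by (rule sum.subset_diff) (use Pm[OF a] in auto)
    also have "(\<Sum>c\<in>{1..m} - P a. of_bool (D a + of_bool (c \<in> P a) = k)) =
      (\<Sum>c\<in>{1..m} - P a. of_bool (D a = k) :: real)"
      by (rule sum.cong) auto
    also have "(\<Sum>c\<in>P a. of_bool (D a + of_bool (c \<in> P a) = k)) =
      (\<Sum>c\<in>P a. of_bool (Suc (D a) = k) :: real)"
      by (rule sum.cong) auto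
    finally have "(\<Sum>c\<in>{1..m}. of_bool (D a + of_bool (c \<in> P a) = k)) =
      real (card ({1..m} - P a)) * of_bool (D a = k) + real (D a) * of_bool (Suc (D a) = k)"
      by (simp add: cardP[OF a])
    moreover have "real (card ({1..m} - P a)) = real m - real (D a)"
      using card_mono[OF _ Pm[OF a]] card_Diff_subset[OF finP Pm[OF a]] cardP[OF a] by (simp add: of_nat_diff)
    ultimately show ?thesis by (auto simp: of_bool_def)
  qed
  have "(\<Sum>c\<in>{1..m}. real (card {a \<in> {1..i}. D a + of_bool (c \<in> P a) = k})) =
    (\<Sum>c\<in>{1..m}. \<Sum>a\<in>{1..i}. of_bool (D a + of_bool (c \<in> P a) = k))"
    by (simp add: sum.If_cases of_bool_def Int_def)
  also have "\<dots> = (\<Sum>a\<in>{1..i}. \<Sum>c\<in>{1..m}. of_bool (D a + of_bool (c \<in> P a) = k))"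
    by (rule sum.swap)
  also have "\<dots> = (\<Sum>a\<in>{1..i}. of_bool (D a = k) * (real m - real k) + of_bool (Suc (D a) = k) * (real k - 1))"
    by (rule sum.cong[OF refl sum_a])
  also have "\<dots> = real (card {a \<in> {1..i}. D a = k}) * (real m - real k) +
    real (card {a \<in> {1..i}. Suc (D a) = k}) * (real k - 1)"
    by (simp add: sum.distrib sum_distrib_right[symmetric]) (simp add: sum.If_cases of_bool_def Int_def)
  finally have old: "(\<Sum>c\<in>{1..m}. real (card {a \<in> {1..i}. D a + of_bool (c \<in> P a) = k})) = \<dots>" .
  have empty: "card {c \<in> {1..m}. content ?T c = None} = m - i"
    using card_usearch_0 \<open>i < m\<close> by (simp add: ucount_def usearch_eq_0)
  have occd: "card {c \<in> {1..m}. content ?T c \<noteq> None} = i"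
  proof -
    have "{c \<in> {1..m}. content ?T c \<noteq> None} = {c. content ?T c \<noteq> None}" using cells by blast
    with card_occ show ?thesis by simp
  qed
  \<comment> \<open>The new item has displacement 0 at the \<open>m - i\<close> empty addresses and
    1 at the \<open>i\<close> occupied ones.\<close>
  have new: "(\<Sum>c\<in>{1..m}. of_bool (of_bool (content ?T c \<noteq> None) = k)) =
    (if k = 0 then real m - real i else if k = 1 then real i else 0)"
  proof -
    have "(\<Sum>c\<in>{1..m}. of_bool (of_bool (content ?T c \<noteq> None) = k)) =
      real (card {c \<in> {1..m}. of_bool (content ?T c \<noteq> None) = k})"
      by (simp add: sum.If_cases of_bool_def Int_def)
    moreover have "{c \<in> {1..m}. of_bool (content ?T c \<noteq> None) = k} =
      (if k = 0 then {c \<in> {1..m}. content ?T c = None}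
       else if k = 1 then {c \<in> {1..m}. content ?T c \<noteq> None} else {})"
      by (auto simp: of_bool_def split: if_splits)
    ultimately show ?thesis using empty occd \<open>i < m\<close> by (simp add: of_nat_diff)
  qed
  have "(\<Sum>c\<in>{1..m}. real (num_displacement Early m (Suc i) (h(Suc i := c)) k) -
      real (num_displacement Early m i h k)) =
    (\<Sum>c\<in>{1..m}. real (card {a \<in> {1..i}. D a + of_bool (c \<in> P a) = k}) +
      of_bool (of_bool (content ?T c \<noteq> None) = k) - real (card {a \<in> {1..i}. D a = k}))"
    by (rule sum.cong) (simp_all add: step N)
  also have "\<dots> = real (card {a \<in> {1..i}. Suc (D a) = k}) * (real k - 1)
    - real k * real (card {a \<in> {1..i}. D a = k}) +
    (if k = 0 then real m - real i else if k = 1 then real i else 0)"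
    unfolding sum_subtractf sum.distrib old new by (simp add: algebra_simps)
  also have "\<dots> = (if k = 0 then real (num_unsuccessful Early m i h 0)
       else (if k = 1 then real i else real (k - 1) * real (num_displacement Early m i h (k - 1)))
         - real k * real (num_displacement Early m i h k))"
  proof (cases k)
    case 0
    then show ?thesis using num_unsuccessful_0[of Early] \<open>i < m\<close> by (simp add: of_nat_diff)
  next
    case (Suc k')
    then show ?thesis by (simp add: N)
  qed
  finally show "(\<Sum>c\<in>{1..m}. real (num_displacement Early m (Suc i) (h(Suc i := c)) k) -
      real (num_displacement Early m i h k)) = \<dots>" .
qed

end

section \<open>Second moments\<close>

lemma set_random_table:
  assumes "h \<in> set_pmf (random_table m i)" "a \<in> {1..i}" "0 < m"
  shows "h a \<in> {1..m}"
  using assms unfolding random_table_def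
  by (auto simp: set_Pi_pmf PiE_dflt_def)

text \<open>With finite support every real function is integrable.\<close>

lemma finite_random_table: "0 < m \<Longrightarrow> finite (set_pmf (random_table m i))"
  unfolding random_table_def by (subst set_Pi_pmf) (auto intro!: finite_PiE_dflt)

lemma expectation_mono:
  fixes f g :: "'a \<Rightarrow> real"
  assumes "finite (set_pmf p)" "\<And>x. x \<in> set_pmf p \<Longrightarrow> f x \<le> g x"
  shows "measure_pmf.expectation p f \<le> measure_pmf.expectation p g"
  using assms by (intro integral_mono_AE integrable_measure_pmf_finite) (auto simp: AE_measure_pmf_iff)

text \<open>The last address is uniform and independent of the earlier ones, so conditioning on
  these leaves an average over \<open>c\<close>.\<close>

lemma expectation_random_table_Suc:
  fixes f :: "(nat \<Rightarrow> nat) \<Rightarrow> real"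
  assumes "0 < m"
  shows "measure_pmf.expectation (random_table m (Suc i)) f =
    measure_pmf.expectation (random_table m i) (\<lambda>h. (\<Sum>c\<in>{1..m}. f (h(Suc i := c))) / real m)"
proof -
  have fin: "finite (set_pmf (random_table m i))" using finite_random_table[OF assms] .
  have ne: "{1..m} \<noteq> {}" using assms by simp
  have "random_table m (Suc i) =
    pmf_of_set {1..m} \<bind> (\<lambda>c. random_table m i \<bind> (\<lambda>h. return_pmf (h(Suc i := c))))"
  proof -
    have "{1..Suc i} = insert (Suc i) {1..i}" by auto
    then show ?thesis unfolding random_table_def by (simp only:) (rule Pi_pmf_insert'; simp)
  qed
  also have "measure_pmf.expectation \<dots> f = (\<Sum>c\<in>{1..m}. pmf (pmf_of_set {1..m}) c *\<^sub>R
    measure_pmf.expectation (random_table m i \<bind> (\<lambda>h. return_pmf (h(Suc i := c)))) f)"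
    using ne fin by (intro pmf_expectation_bind) auto
  also have "\<dots> = (\<Sum>c\<in>{1..m}. measure_pmf.expectation (random_table m i) (\<lambda>h. f (h(Suc i := c)) / real m))"
    using ne by (intro sum.cong) (auto simp: map_pmf_def[symmetric])
  also have "\<dots> = measure_pmf.expectation (random_table m i) (\<lambda>h. \<Sum>c\<in>{1..m}. f (h(Suc i := c)) / real m)"
    by (rule Bochner_Integration.integral_sum[symmetric]) (intro integrable_measure_pmf_finite fin)
  finally show ?thesis by (simp add: sum_divide_distrib)
qed

text \<open>The constant \<open>C\<close> is uniform in \<open>m\<close> and \<open>i\<close>. The
  Lipschitz condition is carried along because \<open>x\<close> enters the derivative of the next
  function in the hierarchy, whose Taylor remainder it controls.\<close>

definition tracks :: "(nat \<Rightarrow> nat \<Rightarrow> (nat \<Rightarrow> nat) \<Rightarrow> real) \<Rightarrow> (real \<Rightarrow> real) \<Rightarrow> bool" where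
  "tracks X x \<longleftrightarrow> (\<exists>L. L-lipschitz_on {0..1} x) \<and>
     (\<exists>C\<ge>0. \<forall>m>0. \<forall>i\<le>m.
        measure_pmf.expectation (random_table m i) (\<lambda>h. (X m i h - real m * x (real i / real m))\<^sup>2) \<le> C * real i)"

text \<open>Start of the inductions, for counts that are deterministic, such as the number of empty
  cells or of items.\<close>

lemma tracks_exact:
  assumes "L-lipschitz_on {0..1} x"
    and exact: "\<And>m i h. 0 < m \<Longrightarrow> i \<le> m \<Longrightarrow> (\<And>a. a \<in> {1..i} \<Longrightarrow> h a \<in> {1..m}) \<Longrightarrow>
      X m i h = real m * x (real i / real m)"
  shows "tracks X x"
proof -
  have "measure_pmf.expectation (random_table m i) (\<lambda>h. (X m i h - real m * x (real i / real m))\<^sup>2) \<le> 0 * real i"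
    if "0 < m" "i \<le> m" for m i
  proof -
    have "measure_pmf.expectation (random_table m i) (\<lambda>h. (X m i h - real m * x (real i / real m))\<^sup>2) \<le>
      measure_pmf.expectation (random_table m i) (\<lambda>_. 0)"
    proof (rule expectation_mono[OF finite_random_table[OF that(1)]])
      fix h assume "h \<in> set_pmf (random_table m i)"
      then have "X m i h = real m * x (real i / real m)"
        using that set_random_table by (intro exact) blast+
      then show "(X m i h - real m * x (real i / real m))\<^sup>2 \<le> 0" by simp
    qed
    then show ?thesis by simp
  qed
  then show ?thesis unfolding tracks_def using assms(1) by blast
qed

text \<open>A discrete Gronwall inequality. Each step adds at most \<open>B\<close>, and the growth
  factor over at most \<open>m\<close> steps is at most \<open>exp K\<close>; since the start is at
  most 0, the bound is linear in \<open>i\<close>.\<close>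

lemma growth_recurrence:
  fixes S :: "nat \<Rightarrow> real"
  assumes "S 0 \<le> 0" "\<And>i. i < m \<Longrightarrow> S (Suc i) \<le> (1 + K / real m) * S i + B" "0 \<le> K" "0 \<le> B" "i \<le> m"
  shows "S i \<le> B * exp K * real i"
proof -
  have "S i \<le> B * real i * (1 + K / real m) ^ i" using \<open>i \<le> m\<close>
  proof (induction i)
    case (Suc i)
    have "S (Suc i) \<le> (1 + K / real m) * S i + B" using assms Suc by simp
    also have "\<dots> \<le> (1 + K / real m) * (B * real i * (1 + K / real m) ^ i) + B * (1 + K / real m) ^ Suc i"
    proof (intro add_mono mult_left_mono)
      show "S i \<le> B * real i * (1 + K / real m) ^ i" using Suc by simp
      have "1 \<le> (1 + K / real m) ^ Suc i" using assms by (intro one_le_power) simp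
      then show "B \<le> B * (1 + K / real m) ^ Suc i" using mult_left_mono[of 1 _ B] assms by simp
    qed (use assms in simp)
    also have "\<dots> = B * real (Suc i) * (1 + K / real m) ^ Suc i" by (simp add: algebra_simps add_divide_distrib)
    finally show ?case .
  qed (use assms in simp)
  also have "(1 + K / real m) ^ i \<le> exp K"
  proof (cases "m = 0")
    case False
    have "(1 + K / real m) ^ i \<le> (1 + K / real m) ^ m" using assms by (intro power_increasing) auto
    also have "\<dots> \<le> exp (K / real m) ^ m" using assms exp_ge_add_one_self[of "K / real m"] by (intro power_mono) auto
    also have "\<dots> = exp K" using False by (simp add: exp_of_nat_mult[symmetric])
    finally show ?thesis .
  qed (use assms in simp)
  then have "B * real i * (1 + K / real m) ^ i \<le> B * real i * exp K" using assms by (intro mult_left_mono) auto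
  finally show ?thesis by (simp add: mult_ac)
qed

text \<open>The mean value inequality, as the continuous derivative is bounded on the compact
  interval.\<close>

lemma lipschitz_of_derivative:
  fixes x :: "real \<Rightarrow> real"
  assumes deriv: "\<And>t. t \<in> {0..1} \<Longrightarrow> (x has_real_derivative x' t) (at t within {0..1})"
    and "continuous_on {0..1} x'"
  obtains M where "0 \<le> M" "\<And>s t. s \<in> {0..1} \<Longrightarrow> t \<in> {0..1} \<Longrightarrow> \<bar>x s - x t\<bar> \<le> M * \<bar>s - t\<bar>"
proof -
  have "bounded (x' ` {0..1})" using assms(2) by (intro compact_imp_bounded compact_continuous_image) auto
  then obtain M where "\<forall>y \<in> x' ` {0..1}. norm y \<le> M" unfolding bounded_iff by blast
  then have M: "\<bar>x' t\<bar> \<le> M" if "t \<in> {0..1}" for t using that by simp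
  have "\<bar>x s - x t\<bar> \<le> M * \<bar>s - t\<bar>" if "s \<in> {0..1}" "t \<in> {0..1}" for s t
    using field_differentiable_bound[OF _ deriv, of M] M that by (auto simp: real_norm_def)
  moreover have "0 \<le> M" using M[of 0] by simp
  ultimately show ?thesis using that by blast
qed

text \<open>The mean value inequality applied to \<open>x z - z * x' t\<close>, whose derivative
  \<open>x' z - x' t\<close> is at most \<open>K * (t' - t)\<close> in absolute value.\<close>

lemma second_order_bound:
  fixes x :: "real \<Rightarrow> real"
  assumes deriv: "\<And>t. t \<in> {0..1} \<Longrightarrow> (x has_real_derivative x' t) (at t within {0..1})"
    and lip: "\<And>s t. s \<in> {0..1} \<Longrightarrow> t \<in> {0..1} \<Longrightarrow> \<bar>x' s - x' t\<bar> \<le> K * \<bar>s - t\<bar>"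
    and "0 \<le> K" "0 \<le> t" "t \<le> t'" "t' \<le> 1"
  shows "\<bar>x t' - x t - (t' - t) * x' t\<bar> \<le> K * (t' - t)\<^sup>2"
proof -
  have "norm ((\<lambda>z. x z - z * x' t) t' - (\<lambda>z. x z - z * x' t) t) \<le> (K * (t' - t)) * norm (t' - t)"
  proof (rule field_differentiable_bound[where S = "{t..t'}" and f' = "\<lambda>z. x' z - x' t"])
    fix z assume z: "z \<in> {t..t'}"
    have "(x has_real_derivative x' z) (at z within {t..t'})"
      by (rule DERIV_subset[OF deriv]) (use z assms in auto)
    then show "((\<lambda>z. x z - z * x' t) has_real_derivative x' z - x' t) (at z within {t..t'})"
      by (auto intro!: derivative_eq_intros)
    have "\<bar>x' z - x' t\<bar> \<le> K * \<bar>z - t\<bar>" using z assms by (intro lip) auto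
    also have "\<dots> \<le> K * (t' - t)" using z assms by (intro mult_left_mono) auto
    finally show "norm (x' z - x' t) \<le> K * (t' - t)" by simp
  qed (use assms in auto)
  then show ?thesis using assms by (simp add: algebra_simps power2_eq_square)
qed

text \<open>In the application \<open>D\<close> and \<open>E\<close> are the present deviations of
  the count and of the count driving it, \<open>\<Delta> c\<close> is the random and
  \<open>\<delta>\<close> the deterministic increment. In the expanded square, the cross term
  contains only the mean of \<open>\<Delta> c - \<delta>\<close>, which is small, and the last term
  is at most \<open>R\<^sup>2\<close>.\<close>

lemma mean_square_step:
  fixes \<Delta> :: "nat \<Rightarrow> real"
  assumes "0 < m" and \<Delta>: "\<And>c. c \<in> {1..m} \<Longrightarrow> \<bar>\<Delta> c - \<delta>\<bar> \<le> R"
    and mean: "\<bar>(\<Sum>c\<in>{1..m}. \<Delta> c) / real m - \<delta>\<bar> \<le> (A * \<bar>E\<bar> + b * \<bar>D\<bar> + K) / real m"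
    and "0 \<le> A" "0 \<le> b" "0 \<le> K"
  shows "(\<Sum>c\<in>{1..m}. (D + \<Delta> c - \<delta>)\<^sup>2) / real m \<le>
    (1 + (A + 2 * b + K) / real m) * D\<^sup>2 + A / real m * E\<^sup>2 + K + R\<^sup>2"
proof -
  have "(\<Sum>c\<in>{1..m}. (D + \<Delta> c - \<delta>)\<^sup>2) =
    (\<Sum>c\<in>{1..m}. D\<^sup>2 - 2 * D * \<delta> + 2 * D * \<Delta> c + (\<Delta> c - \<delta>)\<^sup>2)"
    by (rule sum.cong) (auto simp: power2_eq_square algebra_simps)
  also have "\<dots> = real m * (D\<^sup>2 - 2 * D * \<delta>) + 2 * D * (\<Sum>c\<in>{1..m}. \<Delta> c) + (\<Sum>c\<in>{1..m}. (\<Delta> c - \<delta>)\<^sup>2)"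
    by (simp add: sum.distrib sum_distrib_left)
  also have "(\<Sum>c\<in>{1..m}. (\<Delta> c - \<delta>)\<^sup>2) \<le> real m * R\<^sup>2"
  proof -
    have "(\<Delta> c - \<delta>)\<^sup>2 \<le> R\<^sup>2" if "c \<in> {1..m}" for c
      using power_mono[OF \<Delta>[OF that], of 2] by simp
    then show ?thesis using sum_bounded_above[of "{1..m}" "\<lambda>c. (\<Delta> c - \<delta>)\<^sup>2" "R\<^sup>2"] by simp
  qed
  finally have "(\<Sum>c\<in>{1..m}. (D + \<Delta> c - \<delta>)\<^sup>2) / real m \<le>
    (real m * (D\<^sup>2 - 2 * D * \<delta>) + 2 * D * (\<Sum>c\<in>{1..m}. \<Delta> c) + real m * R\<^sup>2) / real m"
    by (simp add: divide_right_mono)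
  also have "\<dots> = D\<^sup>2 + 2 * D * ((\<Sum>c\<in>{1..m}. \<Delta> c) / real m - \<delta>) + R\<^sup>2"
    using \<open>0 < m\<close> by (simp add: field_simps)
  also have "2 * D * ((\<Sum>c\<in>{1..m}. \<Delta> c) / real m - \<delta>) \<le> 2 * \<bar>D\<bar> * ((A * \<bar>E\<bar> + b * \<bar>D\<bar> + K) / real m)"
  proof -
    have "2 * D * ((\<Sum>c\<in>{1..m}. \<Delta> c) / real m - \<delta>) \<le> 2 * \<bar>D\<bar> * \<bar>(\<Sum>c\<in>{1..m}. \<Delta> c) / real m - \<delta>\<bar>"
      using abs_ge_self[of "D * ((\<Sum>c\<in>{1..m}. \<Delta> c) / real m - \<delta>)"] by (simp add: abs_mult)
    also have "\<dots> \<le> 2 * \<bar>D\<bar> * ((A * \<bar>E\<bar> + b * \<bar>D\<bar> + K) / real m)"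
      using mean by (intro mult_left_mono) auto
    finally show ?thesis .
  qed
  also have "\<dots> = (A * (2 * \<bar>D\<bar> * \<bar>E\<bar>) + 2 * b * D\<^sup>2 + K * (2 * \<bar>D\<bar>)) / real m"
    by (simp add: algebra_simps power2_eq_square)
  \<comment> \<open>The products are removed by \<open>2 * \<bar>D\<bar> * \<bar>E\<bar> \<le>
    D\<^sup>2 + E\<^sup>2\<close> and \<open>2 * \<bar>D\<bar> \<le> D\<^sup>2 + 1\<close>.\<close>
  also have "\<dots> \<le> (A * (D\<^sup>2 + E\<^sup>2) + 2 * b * D\<^sup>2 + K * (D\<^sup>2 + 1)) / real m"
    using sum_squares_bound[of "\<bar>D\<bar>" "\<bar>E\<bar>"] sum_squares_bound[of "\<bar>D\<bar>" 1] assms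
    by (intro divide_right_mono add_mono mult_left_mono) auto
  also have "\<dots> = (A + 2 * b + K) / real m * D\<^sup>2 + A / real m * E\<^sup>2 + K / real m"
    using \<open>0 < m\<close> by (simp add: field_simps)
  also have "K / real m \<le> K" using assms by (simp add: field_simps mult_left_mono[of 1 "real m" K, simplified])
  finally show ?thesis by (simp add: algebra_simps)
qed

text \<open>The induction step of the hierarchy. The mean increment of \<open>X\<close> differs from
  that of the curve by the two deviations, with weights \<open>a / m\<close> and
  \<open>b / m\<close>, plus a discretisation error of order \<open>1 / m\<close>. The second moment
  of the deviation therefore obeys the recurrence of \<open>growth_recurrence\<close>.\<close>

lemma tracks_step:
  fixes x y :: "real \<Rightarrow> real"
  assumes Y: "tracks Y y"
    and init: "\<And>m h. X m 0 h = 0" "x 0 = 0"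
    and bounded: "\<And>m i h c. i < m \<Longrightarrow> (\<And>a. a \<in> {1..i} \<Longrightarrow> h a \<in> {1..m}) \<Longrightarrow> c \<in> {1..m} \<Longrightarrow>
      \<bar>X m (Suc i) (h(Suc i := c)) - X m i h\<bar> \<le> B"
    and drift: "\<And>m i h. i < m \<Longrightarrow> (\<And>a. a \<in> {1..i} \<Longrightarrow> h a \<in> {1..m}) \<Longrightarrow>
      (\<Sum>c\<in>{1..m}. X m (Suc i) (h(Suc i := c)) - X m i h) = a * Y m i h + b * X m i h"
    and deriv: "\<And>t. t \<in> {0..1} \<Longrightarrow> (x has_real_derivative a * y t + b * x t) (at t within {0..1})"
  shows "tracks X x"
proof -
  obtain C where "0 \<le> C" and C: "\<And>m i. 0 < m \<Longrightarrow> i \<le> m \<Longrightarrow>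
    measure_pmf.expectation (random_table m i) (\<lambda>h. (Y m i h - real m * y (real i / real m))\<^sup>2) \<le> C * real i"
    using Y unfolding tracks_def by blast
  have contx: "continuous_on {0..1} x"
    using deriv by (intro continuous_on_vector_derivative) (auto simp: has_real_derivative_iff_has_vector_derivative)
  obtain L where L: "L-lipschitz_on {0..1} y" using Y unfolding tracks_def by blast
  then have conty: "continuous_on {0..1} y" by (rule lipschitz_on_continuous_on)
  have Ly: "\<bar>y s - y t\<bar> \<le> L * \<bar>s - t\<bar>" "0 \<le> L" if "s \<in> {0..1}" "t \<in> {0..1}" for s t
    using lipschitz_onD[OF L that] lipschitz_on_nonneg[OF L] by (auto simp: dist_real_def)
  obtain M where "0 \<le> M" and M: "\<And>s t. s \<in> {0..1} \<Longrightarrow> t \<in> {0..1} \<Longrightarrow> \<bar>x s - x t\<bar> \<le> M * \<bar>s - t\<bar>"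
    by (rule lipschitz_of_derivative[OF deriv]) (use contx conty in \<open>auto intro!: continuous_intros\<close>)
  \<comment> \<open>A Lipschitz constant of the derivative \<open>a * y t + b * x t\<close>.\<close>
  define K where "K = \<bar>a\<bar> * L + \<bar>b\<bar> * M"
  have "0 \<le> K" using \<open>0 \<le> M\<close> Ly(2)[of 0 0] by (simp add: K_def)
  have lipK: "\<bar>(a * y s + b * x s) - (a * y t + b * x t)\<bar> \<le> K * \<bar>s - t\<bar>" if "s \<in> {0..1}" "t \<in> {0..1}" for s t
  proof -
    have "\<bar>(a * y s + b * x s) - (a * y t + b * x t)\<bar> = \<bar>a * (y s - y t) + b * (x s - x t)\<bar>"
      by (simp add: algebra_simps)
    also have "\<dots> \<le> \<bar>a\<bar> * \<bar>y s - y t\<bar> + \<bar>b\<bar> * \<bar>x s - x t\<bar>"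
      by (metis abs_mult abs_triangle_ineq)
    also have "\<dots> \<le> \<bar>a\<bar> * (L * \<bar>s - t\<bar>) + \<bar>b\<bar> * (M * \<bar>s - t\<bar>)"
      using Ly(1)[OF that] M[OF that] by (intro add_mono mult_left_mono) auto
    finally show ?thesis by (simp add: K_def algebra_simps)
  qed
  \<comment> \<open>The constants of \<open>mean_square_step\<close> after taking expectations:
    \<open>K1 / m\<close> is the excess growth factor, and \<open>R\<close> collects the
    contribution \<open>\<bar>a\<bar> * C\<close> of \<open>Y\<close>, the discretisation error and
    the squared increment.\<close>
  define K1 where "K1 = \<bar>a\<bar> + 2 * \<bar>b\<bar> + K"
  define R where "R = \<bar>a\<bar> * C + K + (B + M)\<^sup>2"
  have K1: "0 \<le> K1" "0 \<le> R" using \<open>0 \<le> K\<close> \<open>0 \<le> C\<close> by (auto simp: K1_def R_def)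
  have "measure_pmf.expectation (random_table m i) (\<lambda>h. (X m i h - real m * x (real i / real m))\<^sup>2)
    \<le> R * exp K1 * real i" if m: "0 < m" and i: "i \<le> m" for m i
  proof (rule growth_recurrence[where m = m])
    let ?D = "\<lambda>i h. X m i h - real m * x (real i / real m)"
    let ?E = "\<lambda>i h. Y m i h - real m * y (real i / real m)"
    show "measure_pmf.expectation (random_table m 0) (\<lambda>h. (?D 0 h)\<^sup>2) \<le> 0" using init by simp
    fix i assume i: "i < m"
    let ?t = "real i / real m" and ?t' = "real (Suc i) / real m"
    have t: "?t \<in> {0..1}" "?t' \<in> {0..1}" "?t' - ?t = 1 / real m" "?t \<le> ?t'"
      using i m by (auto simp: field_simps)
    \<comment> \<open>The increment of the deterministic curve \<open>m * x (i / m)\<close> in one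
      step.\<close>
    define \<delta> where "\<delta> = real m * (x ?t' - x ?t)"
    have "\<bar>x ?t' - x ?t\<bar> \<le> M * (1 / real m)" using M[OF t(2,1)] t(3) by simp
    then have "real m * \<bar>x ?t' - x ?t\<bar> \<le> real m * (M * (1 / real m))" by (intro mult_left_mono) auto
    then have \<delta>M: "\<bar>\<delta>\<bar> \<le> M" using m by (simp add: \<delta>_def abs_mult)
    \<comment> \<open>One Euler step of length \<open>1 / m\<close>: the error
      \<open>K / m\<^sup>2\<close> becomes \<open>K / m\<close> after scaling by
      \<open>m\<close>.\<close>
    have "\<bar>x ?t' - x ?t - (?t' - ?t) * (a * y ?t + b * x ?t)\<bar> \<le> K * (?t' - ?t)\<^sup>2"
      using second_order_bound[OF deriv lipK \<open>0 \<le> K\<close>, of ?t ?t'] t by simp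
    then have "real m * \<bar>x ?t' - x ?t - 1 / real m * (a * y ?t + b * x ?t)\<bar> \<le> real m * (K * (1 / real m)\<^sup>2)"
      unfolding t(3) by (intro mult_left_mono) auto
    moreover have "real m * \<bar>x ?t' - x ?t - 1 / real m * (a * y ?t + b * x ?t)\<bar> =
        \<bar>real m * (x ?t' - x ?t - 1 / real m * (a * y ?t + b * x ?t))\<bar>" by (simp add: abs_mult)
    moreover have "real m * (x ?t' - x ?t - 1 / real m * (a * y ?t + b * x ?t)) = \<delta> - (a * y ?t + b * x ?t)"
      using m by (simp add: \<delta>_def right_diff_distrib)
    moreover have "real m * (K * (1 / real m)\<^sup>2) = K / real m"
      using m by (simp add: power2_eq_square)
    ultimately have \<delta>: "\<bar>\<delta> - (a * y ?t + b * x ?t)\<bar> \<le> K / real m" by simp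
    have fin: "finite (set_pmf (random_table m i))" by (rule finite_random_table[OF m])
    have "measure_pmf.expectation (random_table m (Suc i)) (\<lambda>h. (?D (Suc i) h)\<^sup>2) =
      measure_pmf.expectation (random_table m i)
        (\<lambda>h. (\<Sum>c\<in>{1..m}. (?D (Suc i) (h(Suc i := c)))\<^sup>2) / real m)"
      by (rule expectation_random_table_Suc[OF m])
    also have "\<dots> \<le> measure_pmf.expectation (random_table m i)
      (\<lambda>h. (1 + K1 / real m) * (?D i h)\<^sup>2 + \<bar>a\<bar> / real m * (?E i h)\<^sup>2 + (K + (B + M)\<^sup>2))"
    proof (rule expectation_mono[OF fin])
      fix h assume "h \<in> set_pmf (random_table m i)"
      then have valid: "\<And>a. a \<in> {1..i} \<Longrightarrow> h a \<in> {1..m}" using set_random_table m by blast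
      define \<Delta> where "\<Delta> c = X m (Suc i) (h(Suc i := c)) - X m i h" for c
      have "(\<Sum>c\<in>{1..m}. (?D i h + \<Delta> c - \<delta>)\<^sup>2) / real m \<le>
        (1 + (\<bar>a\<bar> + 2 * \<bar>b\<bar> + K) / real m) * (?D i h)\<^sup>2 + \<bar>a\<bar> / real m * (?E i h)\<^sup>2 + K + (B + M)\<^sup>2"
      proof (rule mean_square_step[OF m])
        fix c assume "c \<in> {1..m}"
        then have "\<bar>\<Delta> c\<bar> \<le> B" unfolding \<Delta>_def by (intro bounded[OF i valid])
        then show "\<bar>\<Delta> c - \<delta>\<bar> \<le> B + M" using \<delta>M by linarith
      next
        have "(\<Sum>c\<in>{1..m}. \<Delta> c) = a * Y m i h + b * X m i h"
          unfolding \<Delta>_def by (rule drift[OF i valid])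
        \<comment> \<open>Adding and subtracting \<open>a * y ?t + b * x ?t\<close> separates the
          random deviations from the Euler error.\<close>
        then have "(\<Sum>c\<in>{1..m}. \<Delta> c) / real m - \<delta> =
          (a * ?E i h + b * ?D i h) / real m - (\<delta> - (a * y ?t + b * x ?t))"
          using m by (simp add: field_simps)
        also have "\<bar>\<dots>\<bar> \<le> \<bar>(a * ?E i h + b * ?D i h) / real m\<bar> + K / real m"
        proof -
          have "\<bar>u - v\<bar> \<le> \<bar>u\<bar> + k" if "\<bar>v\<bar> \<le> k" for u v k :: real using that by linarith
          from this[OF \<delta>] show ?thesis .
        qed
        also have "\<bar>(a * ?E i h + b * ?D i h) / real m\<bar> \<le> (\<bar>a\<bar> * \<bar>?E i h\<bar> + \<bar>b\<bar> * \<bar>?D i h\<bar>) / real m"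
          using abs_triangle_ineq[of "a * ?E i h" "b * ?D i h"]
          by (simp add: abs_mult abs_divide divide_right_mono)
        finally show "\<bar>(\<Sum>c\<in>{1..m}. \<Delta> c) / real m - \<delta>\<bar> \<le> (\<bar>a\<bar> * \<bar>?E i h\<bar> + \<bar>b\<bar> * \<bar>?D i h\<bar> + K) / real m"
          by (simp add: add_divide_distrib)
      qed (use \<open>0 \<le> K\<close> in auto)
      moreover have eq: "?D i h + \<Delta> c - \<delta> = ?D (Suc i) (h(Suc i := c))" for c
        by (simp add: \<Delta>_def \<delta>_def algebra_simps)
      ultimately show "(\<Sum>c\<in>{1..m}. (?D (Suc i) (h(Suc i := c)))\<^sup>2) / real m \<le>
        (1 + K1 / real m) * (?D i h)\<^sup>2 + \<bar>a\<bar> / real m * (?E i h)\<^sup>2 + (K + (B + M)\<^sup>2)"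
        by (simp only: eq K1_def add.assoc)
    qed
    also have "\<dots> = (1 + K1 / real m) * measure_pmf.expectation (random_table m i) (\<lambda>h. (?D i h)\<^sup>2) +
      \<bar>a\<bar> / real m * measure_pmf.expectation (random_table m i) (\<lambda>h. (?E i h)\<^sup>2) + (K + (B + M)\<^sup>2)"
      by (simp add: integrable_measure_pmf_finite[OF fin])
    \<comment> \<open>Here \<open>C * i \<le> C * m\<close> suffices: the factor
      \<open>1 / m\<close> makes the contribution of \<open>Y\<close> bounded per step.\<close>
    also have "\<bar>a\<bar> / real m * measure_pmf.expectation (random_table m i) (\<lambda>h. (?E i h)\<^sup>2) \<le> \<bar>a\<bar> / real m * (C * real m)"
    proof (rule mult_left_mono)
      have "measure_pmf.expectation (random_table m i) (\<lambda>h. (?E i h)\<^sup>2) \<le> C * real i"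
        using C m i by simp
      also have "\<dots> \<le> C * real m" using i \<open>0 \<le> C\<close> by (intro mult_left_mono) auto
      finally show "measure_pmf.expectation (random_table m i) (\<lambda>h. (?E i h)\<^sup>2) \<le> C * real m" .
    qed simp
    also have "\<bar>a\<bar> / real m * (C * real m) = \<bar>a\<bar> * C" using m by simp
    finally show "measure_pmf.expectation (random_table m (Suc i)) (\<lambda>h. (?D (Suc i) h)\<^sup>2) \<le>
      (1 + K1 / real m) * measure_pmf.expectation (random_table m i) (\<lambda>h. (?D i h)\<^sup>2) + R"
      by (simp add: R_def algebra_simps)
  qed (use K1 i in auto)
  moreover have "M-lipschitz_on {0..1} x"
    using M \<open>0 \<le> M\<close> by (auto intro!: lipschitz_onI simp: dist_real_def)
  ultimately show ?thesis
    unfolding tracks_def using K1 by (intro conjI exI[of _ "R * exp K1"] exI[of _ M]) auto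
qed

text \<open>Chebyshev's inequality. \<open>N\<close> is the normalisation, later \<open>m\<close> or
  \<open>n\<close>. As \<open>n j \<le> N j\<close>, the second moment is at most
  \<open>C * N j\<close>, whereas the squared threshold is of order \<open>N j\<close> squared; the
  probability is thus of order \<open>1 / N j\<close>.\<close>

lemma tracks_tendsto_in_prob:
  fixes m n N :: "nat \<Rightarrow> nat"
  assumes "tracks X x"
    and mn: "\<And>j. 0 < n j" "\<And>j. n j \<le> N j" "\<And>j. n j \<le> m j"
    and N: "filterlim N at_top sequentially"
    and lim: "(\<lambda>j. real (m j) * x (real (n j) / real (m j)) / real (N j)) \<longlonglongrightarrow> l"
  shows "tendsto_in_prob (\<lambda>j. measure_pmf (random_table (m j) (n j)))
    (\<lambda>j h. X (m j) (n j) h / real (N j)) l"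
  unfolding tendsto_in_prob_def
proof (intro allI impI)
  fix \<epsilon> :: real assume "0 < \<epsilon>"
  obtain C where C: "0 \<le> C" "\<And>m i. 0 < m \<Longrightarrow> i \<le> m \<Longrightarrow>
    measure_pmf.expectation (random_table m i) (\<lambda>h. (X m i h - real m * x (real i / real m))\<^sup>2) \<le> C * real i"
    using assms(1) unfolding tracks_def by blast
  let ?P = "\<lambda>j. measure (measure_pmf (random_table (m j) (n j)))
    {h \<in> space (measure_pmf (random_table (m j) (n j))). \<epsilon> < \<bar>X (m j) (n j) h / real (N j) - l\<bar>}"
  have ev: "\<forall>\<^sub>F j in sequentially. ?P j \<le> 4 * C / \<epsilon>\<^sup>2 * (1 / real (N j))"
  proof -
    have "\<forall>\<^sub>F j in sequentially. dist (real (m j) * x (real (n j) / real (m j)) / real (N j)) l < \<epsilon> / 2"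
      using tendstoD[OF lim, of "\<epsilon> / 2"] \<open>0 < \<epsilon>\<close> by simp
    then show ?thesis
    proof eventually_elim
      case (elim j)
      define p where "p = random_table (m j) (n j)"
      define D where "D h = X (m j) (n j) h - real (m j) * x (real (n j) / real (m j))" for h
      have pos: "0 < m j" "0 < N j" using mn[of j] by auto
      define r where "r = real (N j) * \<epsilon> / 2"
      have "0 < r" using pos \<open>0 < \<epsilon>\<close> by (simp add: r_def)
      have "?P j = measure_pmf.expectation p (indicator {h. \<epsilon> < \<bar>X (m j) (n j) h / real (N j) - l\<bar>})"
        by (simp add: p_def)
      also have "\<dots> \<le> measure_pmf.expectation p (\<lambda>h. (D h)\<^sup>2 / r\<^sup>2)"
      proof (rule expectation_mono)
        show "finite (set_pmf p)" unfolding p_def by (rule finite_random_table[OF pos(1)])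
        fix h
        show "indicator {h. \<epsilon> < \<bar>X (m j) (n j) h / real (N j) - l\<bar>} h \<le> (D h)\<^sup>2 / r\<^sup>2"
        proof (cases "\<epsilon> < \<bar>X (m j) (n j) h / real (N j) - l\<bar>")
          case True
          have "X (m j) (n j) h / real (N j) - real (m j) * x (real (n j) / real (m j)) / real (N j) = D h / real (N j)"
            by (simp add: D_def diff_divide_distrib)
          moreover have "\<epsilon> / 2 < \<bar>d\<bar>" if "\<epsilon> < \<bar>u - l\<bar>" "\<bar>v - l\<bar> < \<epsilon> / 2" "u - v = d" for u v d
            using that by linarith
          \<comment> \<open>The deterministic part is within \<open>\<epsilon> / 2\<close> of
            \<open>l\<close>, so more than \<open>\<epsilon> / 2\<close> is due to the random
            deviation.\<close>
          ultimately have "\<epsilon> / 2 < \<bar>D h / real (N j)\<bar>" using True elim unfolding dist_real_def by blast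
          then have "r \<le> \<bar>D h\<bar>" using pos by (simp add: r_def abs_divide field_simps)
          then have "r\<^sup>2 \<le> (D h)\<^sup>2" using \<open>0 < r\<close> power_mono[of r "\<bar>D h\<bar>" 2] by simp
          then show ?thesis using True \<open>0 < r\<close> by simp
        qed simp
      qed
      also have "\<dots> = measure_pmf.expectation p (\<lambda>h. (D h)\<^sup>2) / r\<^sup>2" by simp
      also have "\<dots> \<le> C * real (N j) / r\<^sup>2"
      proof (rule divide_right_mono)
        have "measure_pmf.expectation p (\<lambda>h. (D h)\<^sup>2) \<le> C * real (n j)"
          unfolding p_def D_def using C(2)[OF pos(1) mn(3)[of j]] .
        also have "\<dots> \<le> C * real (N j)" using C(1) mn(2)[of j] by (intro mult_left_mono) auto
        finally show "measure_pmf.expectation p (\<lambda>h. (D h)\<^sup>2) \<le> C * real (N j)" .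
      qed simp
      also have "\<dots> = 4 * C / \<epsilon>\<^sup>2 * (1 / real (N j))"
        using pos \<open>0 < \<epsilon>\<close> by (simp add: r_def field_simps power2_eq_square)
      finally show ?case .
    qed
  qed
  have "(\<lambda>j. 4 * C / \<epsilon>\<^sup>2 * (1 / real (N j))) \<longlonglongrightarrow> 4 * C / \<epsilon>\<^sup>2 * 0"
  proof (rule tendsto_mult_left)
    have "filterlim (\<lambda>j. real (N j)) at_top sequentially"
      using filterlim_compose[OF filterlim_real_sequentially N] .
    then show "(\<lambda>j. 1 / real (N j)) \<longlonglongrightarrow> 0"
      by (intro tendsto_divide_0[OF tendsto_const] filterlim_at_top_imp_at_infinity)
  qed
  then show "?P \<longlonglongrightarrow> 0"
    by (intro real_tendsto_sandwich[OF _ ev tendsto_const]) (auto simp: measure_nonneg)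
qed

text \<open>The condition \<open>fst \<omega> = h\<close> has positive probability, and by
  independence this probability cancels, leaving the uniform distribution on
  \<open>A\<close>.\<close>

lemma cond_prob_pair_pmf:
  fixes A :: "'b::countable set"
  assumes "h \<in> set_pmf p" "finite A" "A \<noteq> {}"
  shows "\<P>(\<omega> in measure_pmf (pair_pmf p (pmf_of_set A)). f (fst \<omega>) (snd \<omega>) = k \<bar> fst \<omega> = h) =
    real (card {a \<in> A. f h a = k}) / real (card A)"
proof -
  let ?M = "measure_pmf (pair_pmf p (pmf_of_set A))"
  have prod: "measure ?M ({h} \<times> B) = pmf p h * measure (measure_pmf (pmf_of_set A)) B" for B
    by (subst measure_pmf_prob_product) (simp_all add: measure_pmf_single)
  have "{\<omega> \<in> space ?M. f (fst \<omega>) (snd \<omega>) = k \<and> fst \<omega> = h} = {h} \<times> {a. f h a = k}" by auto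
  moreover have "{\<omega> \<in> space ?M. fst \<omega> = h} = {h} \<times> UNIV" by auto
  moreover have "A \<inter> {a. f h a = k} = {a \<in> A. f h a = k}" by auto
  moreover have "pmf p h \<noteq> 0" using assms by (simp add: set_pmf_iff)
  ultimately show ?thesis
    unfolding cond_prob_def using assms by (simp add: prod measure_pmf_of_set)
qed

section \<open>The limiting differential equations\<close>

text \<open>The factor common to the three limit integrals. By natural subtraction it is 1 for
  \<open>k = 0\<close> as well as for \<open>k = 1\<close>.\<close>

definition weight :: "nat \<Rightarrow> real \<Rightarrow> real" where
  "weight k t = (1 - exp (- t)) ^ (k - 1)"

text \<open>The chain rule produces a factor \<open>exp (- t)\<close>, which is rewritten as
  \<open>1 - (1 - exp (- t))\<close>.\<close>

lemma weight_deriv: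
  "(weight k has_real_derivative real (k - 1) * (weight (k - 1) t - weight k t)) (at t within S)"
proof (cases "k - 1")
  case 0
  then show ?thesis by (simp add: weight_def[abs_def])
next
  case (Suc j)
  have "((\<lambda>t. 1 - exp (- t)) has_real_derivative exp (- t)) (at t within S)"
    by (auto intro!: derivative_eq_intros)
  from DERIV_power[OF this, of "Suc j"]
  have "(weight k has_real_derivative of_nat (Suc j) * (exp (- t) * (1 - exp (- t)) ^ (Suc j - Suc 0))) (at t within S)"
    unfolding weight_def[abs_def] Suc .
  then show ?thesis
    by (rule DERIV_cong) (use Suc in \<open>simp add: weight_def algebra_simps\<close>)
qed

lemma continuous_on_weight [continuous_intros]:
  "continuous_on S f \<Longrightarrow> continuous_on S (\<lambda>x. weight k (f x))"
  unfolding weight_def by (intro continuous_intros)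

lemma weight_0: "weight k 0 = of_bool (k \<le> 1)"
  by (cases "k - 1") (auto simp: weight_def)

lemma exp_times_weight: "0 < k \<Longrightarrow> exp (- t) * weight k t = weight k t - weight (Suc k) t"
  by (cases k) (auto simp: weight_def algebra_simps)

text \<open>The limit integrands are polynomials in \<open>s\<close> and the upper bound
  \<open>t\<close>, times weights. Expansion in powers of \<open>s\<close> leaves these moments,
  which can be differentiated by the fundamental theorem of calculus.\<close>

definition weight_moment :: "nat \<Rightarrow> nat \<Rightarrow> real \<Rightarrow> real" where
  "weight_moment j k t = integral {0..t} (\<lambda>s. s ^ j * weight k s)"

lemma weight_moment_integral: "((\<lambda>s. s ^ j * weight k s) has_integral weight_moment j k t) {0..t}"
  unfolding weight_moment_def by (intro integrable_integral integrable_continuous_real continuous_intros)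

lemma weight_moment_deriv:
  assumes "t \<in> {0..1}"
  shows "(weight_moment j k has_real_derivative t ^ j * weight k t) (at t within {0..1})"
  unfolding weight_moment_def by (rule integral_has_real_derivative) (use assms in \<open>auto intro!: continuous_intros\<close>)

lemma weight_moment_at_0 [simp]: "weight_moment j k 0 = 0"
  by (simp add: weight_moment_def)

lemma limit_U_eq: "0 < k \<Longrightarrow> limit_U t k = (1 - t) * weight_moment 0 k t + weight_moment 1 k t"
proof -
  assume "0 < k"
  have "((\<lambda>s. (1 - t) * (s ^ 0 * weight k s) + s ^ 1 * weight k s) has_integral (1 - t) * weight_moment 0 k t + weight_moment 1 k t) {0..t}"
    by (intro has_integral_add has_integral_mult_right weight_moment_integral)
  then have "integral {0..t} (\<lambda>s. (1 - t) * (s ^ 0 * weight k s) + s ^ 1 * weight k s) = (1 - t) * weight_moment 0 k t + weight_moment 1 k t"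
    by (rule integral_unique)
  then show ?thesis using \<open>0 < k\<close> by (simp add: limit_U_def weight_def algebra_simps)
qed

text \<open>Integration of the derivative of \<open>(c + d * s) * weight k s\<close> over
  \<open>{0..t}\<close>. It is used for the factors \<open>1 - t + s\<close> and
  \<open>t - s\<close>.\<close>

lemma weight_moment_by_parts:
  assumes "0 \<le> t"
  shows "real (k - 1) * ((c * weight_moment 0 (k - 1) t + d * weight_moment 1 (k - 1) t) - (c * weight_moment 0 k t + d * weight_moment 1 k t)) =
    (c + d * t) * weight k t - c * weight k 0 - d * weight_moment 0 k t"
proof -
  have 1: "((\<lambda>s. d * (s ^ 0 * weight k s) + (c + d * s) * (real (k - 1) * (weight (k - 1) s - weight k s)))
    has_integral (c + d * t) * weight k t - (c + d * 0) * weight k 0) {0..t}"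
  proof (rule fundamental_theorem_of_calculus[OF assms])
    fix s
    have "((\<lambda>s. (c + d * s) * weight k s) has_real_derivative
      d * (s ^ 0 * weight k s) + (c + d * s) * (real (k - 1) * (weight (k - 1) s - weight k s))) (at s within {0..t})"
      by (auto intro!: derivative_eq_intros weight_deriv)
    then show "((\<lambda>s. (c + d * s) * weight k s) has_vector_derivative
      d * (s ^ 0 * weight k s) + (c + d * s) * (real (k - 1) * (weight (k - 1) s - weight k s))) (at s within {0..t})"
      by (simp add: has_real_derivative_iff_has_vector_derivative)
  qed
  have 2: "((\<lambda>s. d * (s ^ 0 * weight k s) + real (k - 1) *
      ((c * (s ^ 0 * weight (k - 1) s) + d * (s ^ 1 * weight (k - 1) s)) - (c * (s ^ 0 * weight k s) + d * (s ^ 1 * weight k s))))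
    has_integral d * weight_moment 0 k t + real (k - 1) *
      ((c * weight_moment 0 (k - 1) t + d * weight_moment 1 (k - 1) t) - (c * weight_moment 0 k t + d * weight_moment 1 k t))) {0..t}"
    by (intro has_integral_add has_integral_diff has_integral_mult_right weight_moment_integral)
  have eq: "(\<lambda>s. d * (s ^ 0 * weight k s) + real (k - 1) *
      ((c * (s ^ 0 * weight (k - 1) s) + d * (s ^ 1 * weight (k - 1) s)) - (c * (s ^ 0 * weight k s) + d * (s ^ 1 * weight k s)))) =
    (\<lambda>s. d * (s ^ 0 * weight k s) + (c + d * s) * (real (k - 1) * (weight (k - 1) s - weight k s)))"
    by (simp add: fun_eq_iff algebra_simps)
  show ?thesis using has_integral_unique[OF 1 2[unfolded eq]] by simp
qed

lemma weight_moment_1: "0 \<le> t \<Longrightarrow> weight_moment 0 1 t = t"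
  by (simp add: weight_moment_def weight_def)

text \<open>The product rule gives \<open>weight k t - weight_moment 0 k t\<close>, and integration
  by parts with the factor \<open>1 - t + s\<close> turns this into the drift of the chain counts.
  The term \<open>weight k 0\<close> vanishes for \<open>k \<ge> 2\<close>.\<close>

lemma limit_U_deriv:
  assumes "0 < k" "t \<in> {0..1}"
  shows "((\<lambda>t. limit_U t k) has_real_derivative
    (if k = 1 then 1 - t else real (k - 1) * (limit_U t (k - 1) - limit_U t k))) (at t within {0..1})"
proof -
  have "((\<lambda>t. (1 - t) * weight_moment 0 k t + weight_moment 1 k t) has_real_derivative weight k t - weight_moment 0 k t) (at t within {0..1})"
    using assms(2) by (auto intro!: derivative_eq_intros weight_moment_deriv simp: algebra_simps)
  moreover have "weight k t - weight_moment 0 k t =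
    (if k = 1 then 1 - t else real (k - 1) * (limit_U t (k - 1) - limit_U t k))"
    using weight_moment_by_parts[of t k "1 - t" 1] assms by (auto simp: limit_U_eq weight_0 weight_moment_1 weight_def)
  ultimately show ?thesis using assms(1) by (simp add: limit_U_eq)
qed

text \<open>The limiting number of items per cell, that is, \<open>t\<close> times the limit
  probability per item. In contrast to the latter it solves a linear equation with value 0 at
  \<open>t = 0\<close>; the same holds for \<open>mass_E\<close>.\<close>

definition mass_L :: "nat \<Rightarrow> real \<Rightarrow> real" where
  "mass_L k t = (if k = 0 then t - t\<^sup>2 / 2
     else integral {0..t} (\<lambda>s. (t - s - (t - s)\<^sup>2 / 2) * (1 - exp (- s)) ^ (k - 1)))"

definition mass_E :: "nat \<Rightarrow> real \<Rightarrow> real" where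
  "mass_E k t = (if k = 0 then t - t\<^sup>2 / 2
     else integral {0..t} (\<lambda>s. (t - s) * exp (- s) * (1 - exp (- s)) ^ (k - 1)))"

lemma mass_L_eq:
  assumes "0 < k"
  shows "mass_L k t = (t - t\<^sup>2 / 2) * weight_moment 0 k t + (t - 1) * weight_moment 1 k t - 1 / 2 * weight_moment 2 k t"
proof -
  have "((\<lambda>s. (t - t\<^sup>2 / 2) * (s ^ 0 * weight k s) + (t - 1) * (s ^ 1 * weight k s) - 1 / 2 * (s ^ 2 * weight k s)) has_integral
    (t - t\<^sup>2 / 2) * weight_moment 0 k t + (t - 1) * weight_moment 1 k t - 1 / 2 * weight_moment 2 k t) {0..t}"
    by (intro has_integral_add has_integral_diff has_integral_mult_right weight_moment_integral)
  moreover have "(\<lambda>s. (t - t\<^sup>2 / 2) * (s ^ 0 * weight k s) + (t - 1) * (s ^ 1 * weight k s) - 1 / 2 * (s ^ 2 * weight k s)) =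
    (\<lambda>s. (t - s - (t - s)\<^sup>2 / 2) * (1 - exp (- s)) ^ (k - 1))"
    by (simp add: fun_eq_iff weight_def power2_eq_square field_simps)
  ultimately show ?thesis using assms by (auto simp: mass_L_def dest: integral_unique)
qed

text \<open>The kernel \<open>t - s - (t - s)\<^sup>2 / 2\<close> vanishes at \<open>s = t\<close>,
  and its derivative in \<open>t\<close> is \<open>1 - t + s\<close>, the kernel of
  \<open>limit_U\<close>.\<close>

lemma mass_L_deriv:
  assumes "t \<in> {0..1}"
  shows "(mass_L k has_real_derivative limit_U t k) (at t within {0..1})"
proof (cases "k = 0")
  case True
  then show ?thesis unfolding mass_L_def limit_U_def by (auto intro!: derivative_eq_intros)
next
  case False
  have "((\<lambda>t. (t - t\<^sup>2 / 2) * weight_moment 0 k t + (t - 1) * weight_moment 1 k t - 1 / 2 * weight_moment 2 k t) has_real_derivative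
    (1 - t) * weight_moment 0 k t + weight_moment 1 k t) (at t within {0..1})"
    using assms by (auto intro!: derivative_eq_intros weight_moment_deriv simp: field_simps power2_eq_square)
  moreover have "mass_L k = (\<lambda>t. (t - t\<^sup>2 / 2) * weight_moment 0 k t + (t - 1) * weight_moment 1 k t - 1 / 2 * weight_moment 2 k t)"
    using False by (intro ext mass_L_eq) simp
  ultimately show ?thesis using False by (simp add: limit_U_eq)
qed

lemma mass_E_eq:
  assumes "0 < k"
  shows "mass_E k t = t * (weight_moment 0 k t - weight_moment 0 (Suc k) t) - (weight_moment 1 k t - weight_moment 1 (Suc k) t)"
proof -
  have "((\<lambda>s. t * (s ^ 0 * weight k s - s ^ 0 * weight (Suc k) s) - (s ^ 1 * weight k s - s ^ 1 * weight (Suc k) s)) has_integral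
    t * (weight_moment 0 k t - weight_moment 0 (Suc k) t) - (weight_moment 1 k t - weight_moment 1 (Suc k) t)) {0..t}"
    by (intro has_integral_diff has_integral_mult_right weight_moment_integral)
  moreover have "t * (s ^ 0 * weight k s - s ^ 0 * weight (Suc k) s) - (s ^ 1 * weight k s - s ^ 1 * weight (Suc k) s) =
    (t - s) * exp (- s) * (1 - exp (- s)) ^ (k - 1)" for s
  proof -
    have "(t - s) * exp (- s) * (1 - exp (- s)) ^ (k - 1) = (t - s) * (exp (- s) * weight k s)"
      by (simp add: weight_def)
    also have "\<dots> = t * (s ^ 0 * weight k s - s ^ 0 * weight (Suc k) s) - (s ^ 1 * weight k s - s ^ 1 * weight (Suc k) s)"
      unfolding exp_times_weight[OF assms] by (simp add: algebra_simps)
    finally show ?thesis by simp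
  qed
  ultimately show ?thesis using assms by (auto simp: mass_E_def dest: integral_unique)
qed

text \<open>For \<open>k > 0\<close> the kernel \<open>t - s\<close> vanishes at
  \<open>s = t\<close> and has derivative 1 in \<open>t\<close>, which leaves a difference of zeroth
  moments. Integration by parts expresses each of them by the masses.\<close>

lemma mass_E_deriv:
  assumes "t \<in> {0..1}"
  shows "(mass_E k has_real_derivative
    (if k = 0 then limit_U t 0 else (if k = 1 then t else real (k - 1) * mass_E (k - 1) t) - real k * mass_E k t))
    (at t within {0..1})"
proof (cases "k = 0")
  case True
  then show ?thesis unfolding mass_E_def limit_U_def by (auto intro!: derivative_eq_intros)
next
  case False
  have d: "((\<lambda>t. t * (weight_moment 0 k t - weight_moment 0 (Suc k) t) - (weight_moment 1 k t - weight_moment 1 (Suc k) t)) has_real_derivative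
    weight_moment 0 k t - weight_moment 0 (Suc k) t) (at t within {0..1})"
    using assms by (auto intro!: derivative_eq_intros weight_moment_deriv simp: algebra_simps)
  have moments: "weight_moment 0 k t - weight_moment 0 (Suc k) t =
    (if k = 1 then t else real (k - 1) * mass_E (k - 1) t) - real k * mass_E k t"
  proof -
    \<comment> \<open>With \<open>c = t\<close> and \<open>d = -1\<close> the boundary term at
      \<open>s = t\<close> is zero.\<close>
    have 1: "real (k - 1) * ((t * weight_moment 0 (k - 1) t - weight_moment 1 (k - 1) t) - (t * weight_moment 0 k t - weight_moment 1 k t)) =
      weight_moment 0 k t - t * weight k 0"
      using weight_moment_by_parts[of t k t "-1"] assms by simp
    have 2: "real k * ((t * weight_moment 0 k t - weight_moment 1 k t) - (t * weight_moment 0 (Suc k) t - weight_moment 1 (Suc k) t)) =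
      weight_moment 0 (Suc k) t"
      using weight_moment_by_parts[of t "Suc k" t "-1"] assms False by (simp add: weight_0)
    show ?thesis
    proof (cases "k = 1")
      case True
      then show ?thesis using 1 2 assms by (simp add: mass_E_eq weight_0 algebra_simps)
    next
      case k: False
      then have E: "mass_E (k - 1) t = (t * weight_moment 0 (k - 1) t - weight_moment 1 (k - 1) t) - (t * weight_moment 0 k t - weight_moment 1 k t)"
        "mass_E k t = (t * weight_moment 0 k t - weight_moment 1 k t) - (t * weight_moment 0 (Suc k) t - weight_moment 1 (Suc k) t)"
        using False mass_E_eq[of "k - 1" t] mass_E_eq[of k t] by (simp_all add: algebra_simps)
      show ?thesis unfolding E 1 2 using False k by (simp add: weight_0)
    qed
  qed
  have "mass_E k = (\<lambda>t. t * (weight_moment 0 k t - weight_moment 0 (Suc k) t) - (weight_moment 1 k t - weight_moment 1 (Suc k) t))"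
    using False by (intro ext mass_E_eq) simp
  with d have "(mass_E k has_real_derivative weight_moment 0 k t - weight_moment 0 (Suc k) t) (at t within {0..1})"
    by simp
  then show ?thesis
    by (rule DERIV_cong) (simp only: moments False if_False)
qed

section \<open>Values and quotients at the origin\<close>

lemma mass_at_0 [simp]: "mass_L k 0 = 0" "mass_E k 0 = 0"
  by (simp_all add: mass_L_def mass_E_def)

lemma limit_U_at_0: "limit_U 0 k = of_bool (k = 0)"
  by (simp add: limit_U_def)

lemma limit_L_eq: "t \<noteq> 0 \<Longrightarrow> limit_L t k = mass_L k t / t"
  by (simp add: limit_L_def mass_L_def diff_divide_distrib power2_eq_square)

lemma limit_E_eq: "t \<noteq> 0 \<Longrightarrow> limit_E t k = mass_E k t / t"
  by (simp add: limit_E_def mass_E_def diff_divide_distrib power2_eq_square)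

text \<open>For \<alpha> = 0 the quotient is the difference quotient of \<open>x\<close> at 0;
  otherwise continuity of \<open>x\<close> suffices.\<close>

lemma tendsto_div_self:
  fixes x :: "real \<Rightarrow> real"
  assumes deriv: "\<And>t. t \<in> {0..1} \<Longrightarrow> (x has_real_derivative x' t) (at t within {0..1})"
    and "x 0 = 0" and t: "\<And>j. t j \<in> {0<..1}" "t \<longlonglongrightarrow> \<alpha>"
  shows "(\<lambda>j. x (t j) / t j) \<longlonglongrightarrow> (if \<alpha> = 0 then x' 0 else x \<alpha> / \<alpha>)"
proof -
  have t01: "t j \<in> {0..1}" for j using t(1)[of j] by simp
  have "\<alpha> \<in> {0..1}" by (rule closed_sequentially[OF closed_real_atLeastAtMost t01 t(2)])
  show ?thesis
  proof (cases "\<alpha> = 0")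
    case True
    have "((\<lambda>y. x y / y) \<longlongrightarrow> x' 0) (at 0 within {0..1})"
      using deriv[of 0] \<open>x 0 = 0\<close> by (simp add: has_field_derivative_iff)
    moreover have "filterlim t (at 0 within {0..1}) sequentially"
      using t True t01 by (auto simp: filterlim_at intro!: always_eventually) (metis less_irrefl)
    ultimately show ?thesis using True filterlim_compose by fastforce
  next
    case False
    have "continuous (at \<alpha> within {0..1}) x"
      using deriv[OF \<open>\<alpha> \<in> {0..1}\<close>] by (rule DERIV_continuous)
    then have "(\<lambda>j. x (t j)) \<longlonglongrightarrow> x \<alpha>"
      using t t01 by (auto simp: continuous_within_sequentially o_def)
    then show ?thesis using False t(2) by (auto intro!: tendsto_divide)
  qed
qed

section \<open>Convergence\<close>

lemma tracks_num_unsuccessful: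
  "tracks (\<lambda>m i h. real (num_unsuccessful \<Xi> m i h k)) (\<lambda>t. limit_U t k)"
proof (induction k)
  case 0
  show ?case
  proof (rule tracks_exact)
    show "1-lipschitz_on {0..1} (\<lambda>t. limit_U t 0)"
      by (auto intro!: lipschitz_onI simp: limit_U_def dist_real_def)
    fix m i :: nat and h assume i: "0 < m" "i \<le> m" and valid: "\<And>a. a \<in> {1..i} \<Longrightarrow> h a \<in> {1..m}"
    have "num_unsuccessful \<Xi> m i h 0 = m - i" by (rule num_unsuccessful_0[OF valid \<open>i \<le> m\<close>])
    with i show "real (num_unsuccessful \<Xi> m i h 0) = real m * limit_U (real i / real m) 0"
      by (simp add: limit_U_def of_nat_diff field_simps)
  qed
next
  case (Suc k)
  \<comment> \<open>The coefficients depend on \<open>k\<close> because chains of length 1 arise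
    from the empty cells alone, while the count for \<open>Suc k \<ge> 2\<close> grows at rate
    \<open>k\<close> times the difference of two consecutive counts.\<close>
  show ?case
  proof (rule tracks_step[OF Suc, where a = "if k = 0 then 1 else real k"
        and b = "if k = 0 then 0 else - real k" and B = 1])
    show "real (num_unsuccessful \<Xi> m 0 h (Suc k)) = 0" for m h
      by (simp add: num_unsuccessful_def unsuccessful_def)
    show "((\<lambda>t. limit_U t (Suc k)) has_real_derivative
      (if k = 0 then 1 else real k) * limit_U t k + (if k = 0 then 0 else - real k) * limit_U t (Suc k))
      (at t within {0..1})" if "t \<in> {0..1}" for t
      using limit_U_deriv[of "Suc k" t] that by (cases "k = 0") (simp_all add: limit_U_def[of _ 0] algebra_simps)
  next
    fix m i :: nat and h assume "i < m" and valid: "\<And>a. a \<in> {1..i} \<Longrightarrow> h a \<in> {1..m}"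
    show "(\<Sum>c\<in>{1..m}. real (num_unsuccessful \<Xi> m (Suc i) (h(Suc i := c)) (Suc k)) -
        real (num_unsuccessful \<Xi> m i h (Suc k))) =
      (if k = 0 then 1 else real k) * real (num_unsuccessful \<Xi> m i h k) +
      (if k = 0 then 0 else - real k) * real (num_unsuccessful \<Xi> m i h (Suc k))"
      by (simp only: num_unsuccessful_step(2)[OF valid \<open>i < m\<close> zero_less_Suc])
        (cases "k = 0"; simp add: algebra_simps)
    show "\<bar>real (num_unsuccessful \<Xi> m (Suc i) (h(Suc i := c)) (Suc k)) -
        real (num_unsuccessful \<Xi> m i h (Suc k))\<bar> \<le> 1" if "c \<in> {1..m}" for c
      using num_unsuccessful_step(1)[OF valid \<open>i < m\<close> zero_less_Suc that] .
  qed (simp add: limit_U_at_0)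
qed

lemma num_displacement_no_items [simp]: "num_displacement \<Xi> m 0 h k = 0"
  by (simp add: num_displacement_def)

lemma tracks_num_displacement_Late:
  "tracks (\<lambda>m i h. real (num_displacement Late m i h k)) (mass_L k)"
proof (rule tracks_step[OF tracks_num_unsuccessful[of Late k], where a = 1 and b = 0 and B = 1])
  show "(mass_L k has_real_derivative 1 * limit_U t k + 0 * mass_L k t) (at t within {0..1})"
    if "t \<in> {0..1}" for t using mass_L_deriv[OF that] by simp
next
  fix m i :: nat and h assume "i < m" and valid: "\<And>a. a \<in> {1..i} \<Longrightarrow> h a \<in> {1..m}"
  show "(\<Sum>c\<in>{1..m}. real (num_displacement Late m (Suc i) (h(Suc i := c)) k) -
      real (num_displacement Late m i h k)) =
    1 * real (num_unsuccessful Late m i h k) + 0 * real (num_displacement Late m i h k)"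
    by (simp only: num_displacement_Late_step(2)[OF valid \<open>i < m\<close>] mult_1 mult_zero_left add_0_right)
  show "\<bar>real (num_displacement Late m (Suc i) (h(Suc i := c)) k) -
      real (num_displacement Late m i h k)\<bar> \<le> 1" if "c \<in> {1..m}" for c
    using num_displacement_Late_step(1)[OF valid \<open>i < m\<close> that] .
qed simp_all

lemma tracks_num_displacement_Early:
  "tracks (\<lambda>m i h. real (num_displacement Early m i h k)) (mass_E k)"
proof (induction k)
  case 0
  show ?case
  proof (rule tracks_step[OF tracks_num_unsuccessful[of Early 0], where a = 1 and b = 0 and B = "real 0 + 1"])
    show "(mass_E 0 has_real_derivative 1 * limit_U t 0 + 0 * mass_E 0 t) (at t within {0..1})"
      if "t \<in> {0..1}" for t using mass_E_deriv[OF that, of 0] by simp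
  next
    fix m i :: nat and h assume "i < m" and valid: "\<And>a. a \<in> {1..i} \<Longrightarrow> h a \<in> {1..m}"
    show "(\<Sum>c\<in>{1..m}. real (num_displacement Early m (Suc i) (h(Suc i := c)) 0) -
        real (num_displacement Early m i h 0)) =
      1 * real (num_unsuccessful Early m i h 0) + 0 * real (num_displacement Early m i h 0)"
      by (simp only: num_displacement_Early_step(2)[OF valid \<open>i < m\<close>] simp_thms if_True mult_1 mult_zero_left add_0_right)
    show "\<bar>real (num_displacement Early m (Suc i) (h(Suc i := c)) 0) -
        real (num_displacement Early m i h 0)\<bar> \<le> real 0 + 1" if "c \<in> {1..m}" for c
      using num_displacement_Early_step(1)[OF valid \<open>i < m\<close> that] .
  qed simp_all
next
  case (Suc k)
  \<comment> \<open>Level 1 is driven by the number \<open>i\<close> of items, through new items at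
    occupied addresses; higher levels are driven by the level below.\<close>
  define Y where "Y m i h = (if k = 0 then real i else real (num_displacement Early m i h k))"
    for m i :: nat and h
  define y where "y t = (if k = 0 then t else mass_E k t)" for t
  have "tracks (\<lambda>m i h. real i) (\<lambda>t. t)"
  proof (rule tracks_exact)
    show "1-lipschitz_on {0..1} (\<lambda>t::real. t)" by (auto intro!: lipschitz_onI)
  qed simp
  with Suc have Y: "tracks Y y" unfolding Y_def[abs_def] y_def[abs_def] by (cases "k = 0") simp_all
  show ?case
  proof (rule tracks_step[OF Y, where a = "if k = 0 then 1 else real k"
        and b = "- real (Suc k)" and B = "real (Suc k) + 1"])
    show "(mass_E (Suc k) has_real_derivative (if k = 0 then 1 else real k) * y t + - real (Suc k) * mass_E (Suc k) t)
      (at t within {0..1})" if "t \<in> {0..1}" for t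
      using mass_E_deriv[OF that, of "Suc k"] by (rule DERIV_cong) (simp add: y_def algebra_simps)
  next
    fix m i :: nat and h assume "i < m" and valid: "\<And>a. a \<in> {1..i} \<Longrightarrow> h a \<in> {1..m}"
    show "(\<Sum>c\<in>{1..m}. real (num_displacement Early m (Suc i) (h(Suc i := c)) (Suc k)) -
        real (num_displacement Early m i h (Suc k))) =
      (if k = 0 then 1 else real k) * Y m i h + - real (Suc k) * real (num_displacement Early m i h (Suc k))"
      by (simp only: num_displacement_Early_step(2)[OF valid \<open>i < m\<close>])
        (simp add: Y_def algebra_simps)
    show "\<bar>real (num_displacement Early m (Suc i) (h(Suc i := c)) (Suc k)) -
        real (num_displacement Early m i h (Suc k))\<bar> \<le> real (Suc k) + 1" if "c \<in> {1..m}" for c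
      using num_displacement_Early_step(1)[OF valid \<open>i < m\<close> that] .
  qed simp_all
qed

theorem theorem2p5:
  fixes m n :: "nat \<Rightarrow> nat" and \<alpha> :: real and k :: nat
  assumes "filterlim m at_top sequentially" and "filterlim n at_top sequentially"
    and "\<And>j. 0 < n j" and "\<And>j. n j \<le> m j"
    and "0 \<le> \<alpha>" and "\<alpha> \<le> 1"
    and "(\<lambda>j. real (n j) / real (m j)) \<longlonglongrightarrow> \<alpha>"
  shows
    "(\<forall>\<Xi>.
        (\<forall>j. \<forall>h \<in> set_pmf (random_table (m j) (n j)).
           cond_prob_unsuccessful \<Xi> (m j) (n j) k h
             = real (num_unsuccessful \<Xi> (m j) (n j) h k) / real (m j)) \<and>
        tendsto_in_prob (\<lambda>j. measure_pmf (random_table (m j) (n j)))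
          (\<lambda>j h. real (num_unsuccessful \<Xi> (m j) (n j) h k) / real (m j)) (limit_U \<alpha> k)) \<and>
     ((\<forall>j. \<forall>h \<in> set_pmf (random_table (m j) (n j)).
           cond_prob_displacement Late (m j) (n j) k h
             = real (num_displacement Late (m j) (n j) h k) / real (n j)) \<and>
        tendsto_in_prob (\<lambda>j. measure_pmf (random_table (m j) (n j)))
          (\<lambda>j h. real (num_displacement Late (m j) (n j) h k) / real (n j)) (limit_L \<alpha> k)) \<and>
     ((\<forall>j. \<forall>h \<in> set_pmf (random_table (m j) (n j)).
           cond_prob_displacement Early (m j) (n j) k h
             = real (num_displacement Early (m j) (n j) h k) / real (n j)) \<and>
        tendsto_in_prob (\<lambda>j. measure_pmf (random_table (m j) (n j)))
          (\<lambda>j h. real (num_displacement Early (m j) (n j) h k) / real (n j)) (limit_E \<alpha> k))"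
proof -
  define t where "t j = real (n j) / real (m j)" for j
  have t: "t j \<in> {0<..1}" "t j \<in> {0..1}" for j
    using assms(3,4)[of j] by (auto simp: t_def)
  have t_lim: "t \<longlonglongrightarrow> \<alpha>" using assms(7) by (simp add: t_def[abs_def])
  have mpos: "0 < m j" for j using assms(3,4)[of j] by simp
  \<comment> \<open>Dividing by \<open>n\<close> instead of \<open>m\<close> leads to the quotient
    \<open>x (t j) / t j\<close>, which is delicate when \<open>t j\<close> tends to 0.\<close>
  have scale: "real (m j) * x (t j) / real (n j) = x (t j) / t j" for x :: "real \<Rightarrow> real" and j
    using assms(3)[of j] mpos[of j] by (simp add: t_def field_simps)
  have U: "tendsto_in_prob (\<lambda>j. measure_pmf (random_table (m j) (n j)))
    (\<lambda>j h. real (num_unsuccessful \<Xi> (m j) (n j) h k) / real (m j)) (limit_U \<alpha> k)" for \<Xi>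
  proof (rule tracks_tendsto_in_prob[OF tracks_num_unsuccessful assms(3,4,4,1)])
    obtain L where "L-lipschitz_on {0..1} (\<lambda>t. limit_U t k)"
      using tracks_num_unsuccessful unfolding tracks_def by blast
    then have "continuous_on {0..1} (\<lambda>t. limit_U t k)" by (rule lipschitz_on_continuous_on)
    then have "(\<lambda>j. limit_U (t j) k) \<longlonglongrightarrow> limit_U \<alpha> k"
      by (rule continuous_on_tendsto_compose[OF _ t_lim]) (use t assms in auto)
    moreover have "real (m j) * limit_U (real (n j) / real (m j)) k / real (m j) = limit_U (t j) k" for j
      using mpos[of j] by (simp add: t_def)
    ultimately show "(\<lambda>j. real (m j) * limit_U (real (n j) / real (m j)) k / real (m j)) \<longlonglongrightarrow> limit_U \<alpha> k"
      by simp
  qed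
  have L: "tendsto_in_prob (\<lambda>j. measure_pmf (random_table (m j) (n j)))
    (\<lambda>j h. real (num_displacement Late (m j) (n j) h k) / real (n j)) (limit_L \<alpha> k)"
  proof (rule tracks_tendsto_in_prob[OF tracks_num_displacement_Late assms(3) order_refl assms(4,2)])
    \<comment> \<open>At \<alpha> = 0 the derivative of \<open>mass_L k\<close> is 1 for
      \<open>k = 0\<close> and 0 otherwise, in agreement with the separate definition of
      \<open>limit_L\<close> there.\<close>
    have "(if \<alpha> = 0 then limit_U 0 k else mass_L k \<alpha> / \<alpha>) = limit_L \<alpha> k"
      by (simp add: limit_L_eq limit_U_at_0) (simp add: limit_L_def)
    with tendsto_div_self[OF mass_L_deriv mass_at_0(1) t(1) t_lim, of k]
    show "(\<lambda>j. real (m j) * mass_L k (real (n j) / real (m j)) / real (n j)) \<longlonglongrightarrow> limit_L \<alpha> k"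
      by (simp add: scale flip: t_def)
  qed
  have E: "tendsto_in_prob (\<lambda>j. measure_pmf (random_table (m j) (n j)))
    (\<lambda>j h. real (num_displacement Early (m j) (n j) h k) / real (n j)) (limit_E \<alpha> k)"
  proof (rule tracks_tendsto_in_prob[OF tracks_num_displacement_Early assms(3) order_refl assms(4,2)])
    define e where "e t = (if k = 0 then limit_U t 0
      else (if k = 1 then t else real (k - 1) * mass_E (k - 1) t) - real k * mass_E k t)" for t
    have "(mass_E k has_real_derivative e t) (at t within {0..1})" if "t \<in> {0..1}" for t
      unfolding e_def by (rule mass_E_deriv[OF that])
    from tendsto_div_self[OF this mass_at_0(2) t(1) t_lim]
    have "(\<lambda>j. mass_E k (t j) / t j) \<longlonglongrightarrow> (if \<alpha> = 0 then e 0 else mass_E k \<alpha> / \<alpha>)" .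
    \<comment> \<open>Similarly \<open>e 0\<close> is 1 for \<open>k = 0\<close> and 0 for all other
      \<open>k\<close>.\<close>
    moreover have "(if \<alpha> = 0 then e 0 else mass_E k \<alpha> / \<alpha>) = limit_E \<alpha> k"
      by (simp add: limit_E_eq e_def limit_U_at_0) (simp add: limit_E_def)
    ultimately show "(\<lambda>j. real (m j) * mass_E k (real (n j) / real (m j)) / real (n j)) \<longlonglongrightarrow> limit_E \<alpha> k"
      by (simp add: scale flip: t_def)
  qed
  have cU: "cond_prob_unsuccessful \<Xi> (m j) (n j) k h = real (num_unsuccessful \<Xi> (m j) (n j) h k) / real (m j)"
    if "h \<in> set_pmf (random_table (m j) (n j))" for \<Xi> j h
    using cond_prob_pair_pmf[OF that, of "{1..m j}" "unsuccessful \<Xi> (m j) (n j)" k] mpos[of j]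
    by (simp add: cond_prob_unsuccessful_def num_unsuccessful_def)
  have cD: "cond_prob_displacement \<Xi> (m j) (n j) k h = real (num_displacement \<Xi> (m j) (n j) h k) / real (n j)"
    if "h \<in> set_pmf (random_table (m j) (n j))" for \<Xi> j h
    using cond_prob_pair_pmf[OF that, of "{1..n j}" "displacement \<Xi> (m j) (n j)" k] assms(3)[of j]
    by (simp add: cond_prob_displacement_def num_displacement_def)
  show ?thesis using U L E cU cD by blast
qed

end
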